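(* Let $h^0:\mathcal{X}\to\mathbb{R}$ be a candidate value function with $h^0(x)\le \ell(x)$ for all $x\in\mathcal{X}$, and for $t\le 0$ define $$h(x,t)=\min_{\mathfrak{d}\in\Xi}\ \max_{\mathbf{u}\in\mathbb{U}}\ \min\Big\{\min_{s\in[t,0)}\ell\big(\mathbf{x}_{x,t}^{\mathbf{u},\mathfrak{d}}(s)\big),\ h^0\big(\mathbf{x}_{x,t}^{\mathbf{u},\mathfrak{d}}(0)\big)\Big\}.$$ If $h(\cdot,t)$ converges to a function $h^*$ as $t\to-\infty$, then $h^*$ is a safe control barrier value function (safe CBVF) for all $x\in\mathcal{H}^*:=\{x\in\mathcal{X}\mid h^*(x)\ge 0\}$.
   Context: System: $\dot x=F(x,u,d)=f(x)+g(x)u+w(x)d$ with state $x\in\mathcal{X}\subset\mathbb{R}^n$, control $u\in\mathcal{U}\subset\mathbb{R}^m$, disturbance $d\in\mathcal{D}\subset\mathbb{R}^o$, where $\mathcal{U},\mathcal{D}$ are polytopes; $F$ is uniformly continuous, bounded, and Lipschitz continuous in $x$. $\mathbb{U}$ and $\mathbb{D}$ are the sets of measurable control signals $\mathbf{u}$ and disturbance signals $\mathbf{d}$ with values in $\mathcal{U}$ and $\mathcal{D}$; $\Xi$ is the set of nonanticipative disturbance strategies $\mathfrak{d}:\mathbb{U}\to\mathbb{D}$ (the disturbance does not use future knowledge of the control signal). $\mathbf{x}_{x,t}^{\mathbf{u},\mathfrak{d}}(s)$ is the trajectory starting at state $x$ at time $t$ under $\mathbf{u}$ and the disturbance signal $\mathfrak{d}(\mathbf{u})$.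 Constraint set $\mathcal{L}\subseteq\mathcal{X}$ with constraint function $\ell:\mathcal{X}\to\mathbb{R}$ such that $\ell(x)\ge0$ iff $x\in\mathcal{L}$. A set $\mathcal{C}\subseteq\mathcal{X}$ is (robust) control invariant if for every $x\in\mathcal{C}$ and initial time $t$ there is $\mathbf{u}\in\mathbb{U}$ such that for all $\mathfrak{d}\in\Xi$, $\mathbf{x}_{x,t}^{\mathbf{u},\mathfrak{d}}(s)\in\mathcal{C}$ for all $s\ge t$. For a Lipschitz function $h:\mathcal{X}\to\mathbb{R}$ the Lie derivative is $L_Fh(x,u,d)=\langle \frac{\partial h}{\partial x},F(x,u,d)\rangle$ and the Hamiltonian is $L_F^*h(x)=\inf_{d\in\mathcal{D}}\sup_{u\in\mathcal{U}}L_Fh(x,u,d)$ (at points of non-differentiability, via the Clarke generalized gradient). Let $\mathcal{H}=\{x\mid h(x)\ge0\}$ and $\partial\mathcal{H}=\{x\mid h(x)=0\}$. Nagumo's condition: if $\frac{\partial h}{\partial x}\neq0$ on $\partial\mathcal{H}$, then $\mathcal{H}$ is control invariant iff $L_F^*h(x)\ge0$ for all $x\in\partial\mathcal{H}$; this is the sense in which control invariance of 0-superlevel sets is verified. A safe value function is a function $h$ that satisfies Nagumo's condition ($L_F^*h\ge 0$ on $\partial\mathcal{H}$) and whose 0-superlevel set satisfies $\mathcal{H}\subseteq\mathcal{L}$. A function $h$ (differentiable almost everywhere) is a CBVF for all $x$ in a set $S$ if there is an extended class $\mathcal{K}$ function $\alpha$, taken linear, $\alpha(s)=\gamma s$ with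 $\gamma>0$, such that $L_F^*h(x)\ge-\alpha(h(x))$ for all $x\in S$. A safe CBVF is a CBVF that is a safe value function. The function $h(x,t)$ is the viscosity solution of the variational inequality $0=\min\{\ell(x)-h(x,t),\ D_th(x,t)+\max_{u\in\mathcal{U}}\min_{d\in\mathcal{D}}D_xh(x,t)\cdot F(x,u,d)\}$ with $h(x,0)=h^0(x)$, and convergence of $h(\cdot,t)$ to $h^*$ as $t\to-\infty$ means that $h^*$ is a stationary (time-independent) solution of this variational inequality. *)

theory Defs
  imports "HOL-Analysis.Analysis"
begin

section \<open>Control- and disturbance-affine dynamics\<close>

definition control_affine ::
  "(real^'n \<Rightarrow> real^'n) \<Rightarrow> (real^'n \<Rightarrow> real^'m^'n) \<Rightarrow> (real^'n \<Rightarrow> real^'o^'n)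
    \<Rightarrow> real^'n \<Rightarrow> real^'m \<Rightarrow> real^'o \<Rightarrow> real^'n" where
  "control_affine f g w x u d = f x + g x *v u + w x *v d"

definition signals :: "'a::euclidean_space set \<Rightarrow> (real \<Rightarrow> 'a) set" where
  "signals A = {a. a \<in> borel_measurable lebesgue \<and> (\<forall>s. a s \<in> A)}"

text \<open>Signals are functions on the whole time axis and strategies do not mention the initial time
  of the game. A strategy may therefore look at the control before the initial time; that part of
  the control does not influence the trajectory, so the value of the game is not affected.\<close>

definition nonanticipative_strategies ::
  "(real^'m) set \<Rightarrow> (real^'o) set \<Rightarrow> ((real \<Rightarrow> real^'m) \<Rightarrow> (real \<Rightarrow> real^'o)) set" where
  "nonanticipative_strategies U D =
    {\<delta>. (\<forall>u\<in>signals U. \<delta> u \<in> signals D) \<and>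
        (\<forall>u\<in>signals U. \<forall>u'\<in>signals U. \<forall>s.
          (AE \<tau> in lebesgue. \<tau> \<le> s \<longrightarrow> u \<tau> = u' \<tau>) \<longrightarrow>
          (AE \<tau> in lebesgue. \<tau> \<le> s \<longrightarrow> \<delta> u \<tau> = \<delta> u' \<tau>))}"

text \<open>Solutions in the sense of Caratheodory, in integrated form.\<close>

definition solves_from ::
  "(real^'n) set \<Rightarrow> (real^'n \<Rightarrow> real^'m \<Rightarrow> real^'o \<Rightarrow> real^'n) \<Rightarrow> real^'n \<Rightarrow> real
    \<Rightarrow> (real \<Rightarrow> real^'m) \<Rightarrow> (real \<Rightarrow> real^'o) \<Rightarrow> (real \<Rightarrow> real^'n) \<Rightarrow> bool" where
  "solves_from X F x t u d \<xi> \<longleftrightarrow>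
    (\<forall>s\<ge>t. \<xi> s \<in> X \<and> ((\<lambda>\<tau>. F (\<xi> \<tau>) (u \<tau>) (d \<tau>)) has_integral (\<xi> s - x)) {t..s})"

text \<open>The solution is unique on \<open>{t..}\<close> because \<open>F\<close> is Lipschitz in the state; only the irrelevant
  values before \<open>t\<close> depend on the choice operator.\<close>

definition trajectory ::
  "(real^'n) set \<Rightarrow> (real^'n \<Rightarrow> real^'m \<Rightarrow> real^'o \<Rightarrow> real^'n) \<Rightarrow> real^'n \<Rightarrow> real
    \<Rightarrow> (real \<Rightarrow> real^'m) \<Rightarrow> (real \<Rightarrow> real^'o) \<Rightarrow> real \<Rightarrow> real^'n" where
  "trajectory X F x t u d = (SOME \<xi>. solves_from X F x t u d \<xi>)"

text \<open>The last clause says that trajectories stay in the state space, so that functions on the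
  state space can be evaluated along them. It is automatic for \<open>X = UNIV\<close>.\<close>

definition admissible_system ::
  "(real^'n) set \<Rightarrow> (real^'m) set \<Rightarrow> (real^'o) set
    \<Rightarrow> (real^'n \<Rightarrow> real^'m \<Rightarrow> real^'o \<Rightarrow> real^'n) \<Rightarrow> bool" where
  "admissible_system X U D F \<longleftrightarrow>
    open X \<and> polytope U \<and> U \<noteq> {} \<and> polytope D \<and> D \<noteq> {} \<and>
    uniformly_continuous_on (X \<times> U \<times> D) (\<lambda>(x, u, d). F x u d) \<and>
    bounded ((\<lambda>(x, u, d). F x u d) ` (X \<times> U \<times> D)) \<and>
    (\<exists>K. \<forall>u\<in>U. \<forall>d\<in>D. K-lipschitz_on X (\<lambda>x. F x u d)) \<and>
    (\<forall>x\<in>X. \<forall>t. \<forall>u\<in>signals U. \<forall>d\<in>signals D. \<exists>\<xi>. solves_from X F x t u d \<xi>)"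


section \<open>The value function of the game\<close>

text \<open>Minima and maxima over strategies, signals and times are infima and suprema, taken in the
  extended reals because no boundedness of \<open>l\<close> and \<open>h0\<close> is assumed. For \<open>t = 0\<close> the inner infimum
  is over the empty set, hence \<open>\<infinity>\<close>, and the value is \<open>h0 x\<close>.\<close>

definition game_value ::
  "(real^'n) set \<Rightarrow> (real^'m) set \<Rightarrow> (real^'o) set
    \<Rightarrow> (real^'n \<Rightarrow> real^'m \<Rightarrow> real^'o \<Rightarrow> real^'n)
    \<Rightarrow> (real^'n \<Rightarrow> real) \<Rightarrow> (real^'n \<Rightarrow> real) \<Rightarrow> real^'n \<Rightarrow> real \<Rightarrow> ereal" where
  "game_value X U D F l h0 x t =
    (INF \<delta>\<in>nonanticipative_strategies U D. SUP u\<in>signals U.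
      min (INF s\<in>{t..<0}. ereal (l (trajectory X F x t u (\<delta> u) s)))
          (ereal (h0 (trajectory X F x t u (\<delta> u) 0))))"


section \<open>Viscosity solutions of the variational inequality\<close>

definition vi_operator ::
  "(real^'m) set \<Rightarrow> (real^'o) set \<Rightarrow> (real^'n \<Rightarrow> real^'m \<Rightarrow> real^'o \<Rightarrow> real^'n)
    \<Rightarrow> (real^'n \<Rightarrow> real) \<Rightarrow> real^'n \<Rightarrow> real \<Rightarrow> real^'n \<Rightarrow> real \<Rightarrow> real" where
  "vi_operator U D F l x r p q = min (l x - r) (q + (SUP u\<in>U. INF d\<in>D. p \<bullet> F x u d))"

definition C1_test_function ::
  "('a::real_inner) set \<Rightarrow> ('a \<Rightarrow> real) \<Rightarrow> ('a \<Rightarrow> 'a) \<Rightarrow> bool" where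
  "C1_test_function S \<phi> G \<longleftrightarrow> (\<forall>z\<in>S. GDERIV \<phi> z :> G z) \<and> continuous_on S G"

text \<open>The variational inequality \<open>0 = min {l - v, v\<^sub>t + max\<^sub>u min\<^sub>d D\<^sub>xv \<bullet> F}\<close> is solved backwards from
  the terminal time \<open>0\<close>. As usual for terminal value problems, the left-hand side is nonnegative
  for test functions touching from above and nonpositive for those touching from below.\<close>

definition viscosity_solution ::
  "(real^'n) set \<Rightarrow> (real^'m) set \<Rightarrow> (real^'o) set
    \<Rightarrow> (real^'n \<Rightarrow> real^'m \<Rightarrow> real^'o \<Rightarrow> real^'n)
    \<Rightarrow> (real^'n \<Rightarrow> real) \<Rightarrow> ((real^'n) \<times> real \<Rightarrow> real) \<Rightarrow> bool" where
  "viscosity_solution X U D F l v \<longleftrightarrow>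
    continuous_on (X \<times> {..<0}) v \<and>
    (\<forall>\<phi> G. C1_test_function (X \<times> {..<0}) \<phi> G \<longrightarrow>
      (\<forall>x\<in>X. \<forall>t<0.
        ((\<forall>\<^sub>F z in at (x, t). v z - \<phi> z \<le> v (x, t) - \<phi> (x, t)) \<longrightarrow>
           0 \<le> vi_operator U D F l x (v (x, t)) (fst (G (x, t))) (snd (G (x, t)))) \<and>
        ((\<forall>\<^sub>F z in at (x, t). v z - \<phi> z \<ge> v (x, t) - \<phi> (x, t)) \<longrightarrow>
           0 \<ge> vi_operator U D F l x (v (x, t)) (fst (G (x, t))) (snd (G (x, t))))))"

definition stationary_viscosity_solution ::
  "(real^'n) set \<Rightarrow> (real^'m) set \<Rightarrow> (real^'o) set
    \<Rightarrow> (real^'n \<Rightarrow> real^'m \<Rightarrow> real^'o \<Rightarrow> real^'n)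
    \<Rightarrow> (real^'n \<Rightarrow> real) \<Rightarrow> (real^'n \<Rightarrow> real) \<Rightarrow> bool" where
  "stationary_viscosity_solution X U D F l h \<longleftrightarrow>
    viscosity_solution X U D F l (\<lambda>(x, t). h x)"

text \<open>Pointwise convergence alone does not make a limit of viscosity solutions a viscosity solution.
  Convergence of the value function is understood to yield a stationary solution.\<close>

definition value_converges_to ::
  "(real^'n) set \<Rightarrow> (real^'m) set \<Rightarrow> (real^'o) set
    \<Rightarrow> (real^'n \<Rightarrow> real^'m \<Rightarrow> real^'o \<Rightarrow> real^'n)
    \<Rightarrow> (real^'n \<Rightarrow> real) \<Rightarrow> (real^'n \<Rightarrow> real) \<Rightarrow> (real^'n \<Rightarrow> real) \<Rightarrow> bool" where
  "value_converges_to X U D F l h0 hs \<longleftrightarrow>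
    (\<forall>x\<in>X. ((\<lambda>t. game_value X U D F l h0 x t) \<longlongrightarrow> ereal (hs x)) at_bot) \<and>
    stationary_viscosity_solution X U D F l hs"


section \<open>Lie derivatives of Lipschitz functions\<close>

definition locally_lipschitz_on :: "('a::metric_space) set \<Rightarrow> ('a \<Rightarrow> real) \<Rightarrow> bool" where
  "locally_lipschitz_on X h \<longleftrightarrow> (\<forall>x\<in>X. \<exists>e>0. \<exists>K. K-lipschitz_on (ball x e \<inter> X) h)"

definition clarke_dirderiv :: "('a::euclidean_space \<Rightarrow> real) \<Rightarrow> 'a \<Rightarrow> 'a \<Rightarrow> ereal" where
  "clarke_dirderiv h x v =
    Limsup (at (x, 0) within UNIV \<times> {0<..}) (\<lambda>(y, s). ereal ((h (y + s *\<^sub>R v) - h y) / s))"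

definition clarke_gradient :: "('a::euclidean_space \<Rightarrow> real) \<Rightarrow> 'a \<Rightarrow> 'a set" where
  "clarke_gradient h x = {p. \<forall>v. ereal (p \<bullet> v) \<le> clarke_dirderiv h x v}"

text \<open>At points of non-differentiability the derivative in direction \<open>v\<close> is the largest value of
  \<open>p \<bullet> v\<close> over the Clarke generalized gradient, that is, Clarke's generalized directional
  derivative. The smallest value would not do: for \<open>h (x, y) = \<bar>x\<bar> + y\<close>, \<open>F = (u, -1/2)\<close>,
  \<open>u \<in> {-1..1}\<close> and \<open>l = h0 = h\<close>, the value function is \<open>h\<close> for all times, although
  \<open>(0, 1) \<bullet> F < 0\<close> for the element \<open>(0, 1)\<close> of the generalized gradient at \<open>0\<close>.\<close>

definition lie_derivative ::
  "(real^'n \<Rightarrow> real^'m \<Rightarrow> real^'o \<Rightarrow> real^'n) \<Rightarrow> (real^'n \<Rightarrow> real)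
    \<Rightarrow> real^'n \<Rightarrow> real^'m \<Rightarrow> real^'o \<Rightarrow> real" where
  "lie_derivative F h x u d =
    (if h differentiable (at x) then frechet_derivative h (at x) (F x u d)
     else (SUP p\<in>clarke_gradient h x. p \<bullet> F x u d))"

definition lie_hamiltonian ::
  "(real^'m) set \<Rightarrow> (real^'o) set \<Rightarrow> (real^'n \<Rightarrow> real^'m \<Rightarrow> real^'o \<Rightarrow> real^'n)
    \<Rightarrow> (real^'n \<Rightarrow> real) \<Rightarrow> real^'n \<Rightarrow> real" where
  "lie_hamiltonian U D F h x = (INF d\<in>D. SUP u\<in>U. lie_derivative F h x u d)"


section \<open>Safe control barrier value functions\<close>

definition safe_value_function ::
  "(real^'n) set \<Rightarrow> (real^'m) set \<Rightarrow> (real^'o) set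
    \<Rightarrow> (real^'n \<Rightarrow> real^'m \<Rightarrow> real^'o \<Rightarrow> real^'n)
    \<Rightarrow> (real^'n) set \<Rightarrow> (real^'n \<Rightarrow> real) \<Rightarrow> bool" where
  "safe_value_function X U D F L h \<longleftrightarrow>
    (\<forall>x\<in>{x\<in>X. h x = 0}. lie_hamiltonian U D F h x \<ge> 0) \<and> {x\<in>X. h x \<ge> 0} \<subseteq> L"

definition cbvf_on ::
  "(real^'n) set \<Rightarrow> (real^'m) set \<Rightarrow> (real^'o) set
    \<Rightarrow> (real^'n \<Rightarrow> real^'m \<Rightarrow> real^'o \<Rightarrow> real^'n)
    \<Rightarrow> (real^'n \<Rightarrow> real) \<Rightarrow> (real^'n) set \<Rightarrow> bool" where
  "cbvf_on X U D F h S \<longleftrightarrow>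
    (AE x in lebesgue. x \<in> X \<longrightarrow> h differentiable (at x)) \<and>
    (\<exists>\<gamma>>0. \<forall>x\<in>S. lie_hamiltonian U D F h x \<ge> - (\<gamma> * h x))"

definition safe_cbvf_on ::
  "(real^'n) set \<Rightarrow> (real^'m) set \<Rightarrow> (real^'o) set
    \<Rightarrow> (real^'n \<Rightarrow> real^'m \<Rightarrow> real^'o \<Rightarrow> real^'n)
    \<Rightarrow> (real^'n) set \<Rightarrow> (real^'n \<Rightarrow> real) \<Rightarrow> (real^'n) set \<Rightarrow> bool" where
  "safe_cbvf_on X U D F L h S \<longleftrightarrow> cbvf_on X U D F h S \<and> safe_value_function X U D F L h"

end

theory Submission
  imports Defs
begin

text \<open>A function that touches \<open>hs\<close> from above at \<open>y\<close> with gradient \<open>p\<close> has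
  \<open>sup\<^sub>u inf\<^sub>d p \<bullet> F y u d \<ge> 0\<close> by the variational inequality. Paraboloids of curvature \<open>n \<rightarrow> \<infinity>\<close>
  centred at \<open>x\<close> touch at points that tend to \<open>x\<close>. With the tilt \<open>\<nabla>hs x\<close> their gradients tend to
  \<open>\<nabla>hs x\<close> if \<open>hs\<close> is differentiable at \<open>x\<close>; without tilt they stay bounded, and their cluster points
  belong to the Clarke gradient at \<open>x\<close>. Hence the Hamiltonian of \<open>hs\<close> is nonnegative on all of \<open>X\<close>, and
  every \<open>\<gamma>\<close> will do. The inclusion in the constraint set holds because the constraint at the
  initial time bounds the value of the game. Differentiability almost everywhere is Rademacher's
  theorem; it is proved without integration by parts: the partial slopes converge almost
  everywhere by the one-dimensional case and Fubini's theorem, and at almost every point the set of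
  points with nearly the same partial slopes has no large holes, which forces the approximation
  by a linear map in all directions.\<close>

section \<open>Rademacher's theorem\<close>

text \<open>This stands in for the Lebesgue density theorem and does not ask that \<open>S\<close>
  be measurable. Disjoint balls from Vitali's theorem cover a subset \<open>T\<close> of
  \<open>S\<close> inside an open \<open>W\<close> up to a null set, and the sets \<open>U\<close>
  in these balls have at most \<open>c\<close> times the measure of \<open>W\<close>. With
  \<open>W\<close> close to optimal, the outer measure \<open>s\<close> of a bounded
  \<open>T\<close> satisfies \<open>s \<le> c * s\<close>.\<close>

lemma negligible_density_gap:
  fixes S :: "'a::euclidean_space set"
  assumes c: "0 \<le> c" "c < 1"
    and gap: "\<And>x d. x \<in> S \<Longrightarrow> d > 0 \<Longrightarrow> \<exists>a r U. 0 < r \<and> r < d \<and> x \<in> cball a r \<and>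
      S \<inter> cball a r \<subseteq> U \<and> U \<in> lmeasurable \<and> measure lebesgue U \<le> c * measure lebesgue (cball a r)"
  shows "negligible S"
proof -
  let ?\<mu> = "measure lebesgue"
  have step: "\<exists>V \<in> lmeasurable. T \<subseteq> V \<and> ?\<mu> V \<le> c * ?\<mu> W"
    if W: "open W" "W \<in> lmeasurable" "T \<subseteq> W" and TS: "T \<subseteq> S" for T W
  proof -
    let ?K = "{(a, r). 0 < r \<and> cball a r \<subseteq> W \<and>
      (\<exists>U. S \<inter> cball a r \<subseteq> U \<and> U \<in> lmeasurable \<and> ?\<mu> U \<le> c * ?\<mu> (cball a r))}"
    obtain C where "countable C" and Csub: "C \<subseteq> ?K"
      and pwC: "pairwise (\<lambda>i j. disjnt (cball (fst i) (snd i)) (cball (fst j) (snd j))) C"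
      and negC: "negligible (T - (\<Union>i \<in> C. cball (fst i) (snd i)))"
    proof (rule Vitali_covering_theorem_cballs [of ?K snd T fst])
      show "\<And>i. i \<in> ?K \<Longrightarrow> 0 < snd i" by auto
    next
      fix x and d :: real
      assume x: "x \<in> T" and d: "d > 0"
      obtain k where k: "k > 0" "ball x k \<subseteq> W"
        using x W by (meson openE subsetD)
      \<comment> \<open>As \<open>x\<close> need not be the centre, the ball reaches up to
        \<open>2 * r\<close> from \<open>x\<close>; the bound \<open>k/2\<close> keeps it inside
        \<open>W\<close>.\<close>
      obtain a r U where r: "0 < r" "r < min d (k/2)" "x \<in> cball a r" "S \<inter> cball a r \<subseteq> U"
          "U \<in> lmeasurable" "?\<mu> U \<le> c * ?\<mu> (cball a r)"
        using gap[of x "min d (k/2)"] x TS d k by force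
      have "cball a r \<subseteq> ball x k"
      proof
        fix y assume "y \<in> cball a r"
        then have "dist x y \<le> r + r"
          using r(3) dist_triangle_le[of x a y "r + r"] by (auto simp: dist_commute)
        then show "y \<in> ball x k" using r(2) by auto
      qed
      then have "(a, r) \<in> ?K" using r k by blast
      then show "\<exists>i. i \<in> ?K \<and> x \<in> cball (fst i) (snd i) \<and> snd i < d"
        using r by (intro exI[of _ "(a, r)"]) simp
    qed
    have "\<exists>U. S \<inter> cball (fst p) (snd p) \<subseteq> U \<and> U \<in> lmeasurable \<and>
        ?\<mu> U \<le> c * ?\<mu> (cball (fst p) (snd p))" if "p \<in> C" for p
    proof -
      have "p \<in> ?K" using that Csub by blast
      then show ?thesis by (simp only: mem_Collect_eq case_prod_unfold)
    qed
    then obtain U where U: "\<And>p. p \<in> C \<Longrightarrow> S \<inter> cball (fst p) (snd p) \<subseteq> U p"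
        "\<And>p. p \<in> C \<Longrightarrow> U p \<in> lmeasurable"
        "\<And>p. p \<in> C \<Longrightarrow> ?\<mu> (U p) \<le> c * ?\<mu> (cball (fst p) (snd p))"
      by metis
    \<comment> \<open>The bound for the countable union comes from finite subfamilies, where
      disjointness turns the sum over balls into the measure of a subset of
      \<open>W\<close>.\<close>
    have le: "?\<mu> (\<Union>i\<in>I. U i) \<le> c * ?\<mu> W" if I: "I \<subseteq> C" "finite I" for I
    proof -
      have sub: "(\<Union>i\<in>I. cball (fst i) (snd i)) \<subseteq> W" using I Csub by fastforce
      have "?\<mu> (\<Union>i\<in>I. U i) \<le> (\<Sum>i\<in>I. ?\<mu> (U i))"
        using I U by (blast intro: measure_UNION_le)
      also have "\<dots> \<le> (\<Sum>i\<in>I. c * ?\<mu> (cball (fst i) (snd i)))"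
        by (rule sum_mono) (use I U in auto)
      also have "\<dots> = c * ?\<mu> (\<Union>i\<in>I. cball (fst i) (snd i))"
        unfolding sum_distrib_left[symmetric]
        by (subst measure_UNION') (use I pwC in \<open>auto elim: pairwise_mono\<close>)
      also have "\<dots> \<le> c * ?\<mu> W"
        using I(2) sub W(2) c by (intro mult_left_mono measure_mono_fmeasurable) auto
      finally show ?thesis .
    qed
    have m: "\<Union>(U ` C) \<in> lmeasurable" "?\<mu> (\<Union>(U ` C)) \<le> c * ?\<mu> W"
      using fmeasurable_UN_bound [OF \<open>countable C\<close> _ le] measure_UN_bound [OF \<open>countable C\<close> _ le] U
      by auto
    let ?V = "\<Union>(U ` C) \<union> (T - (\<Union>i \<in> C. cball (fst i) (snd i)))"
    show ?thesis
    proof (intro bexI conjI)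
      show "T \<subseteq> ?V" using U(1) TS by fastforce
      show "?V \<in> lmeasurable" using m negC by (simp add: fmeasurable.Un negligible_imp_measurable)
      have "?\<mu> ?V \<le> ?\<mu> (\<Union>(U ` C)) + ?\<mu> (T - (\<Union>i \<in> C. cball (fst i) (snd i)))"
        using m negC by (intro measure_Un_le) (auto simp: negligible_imp_sets)
      then show "?\<mu> ?V \<le> c * ?\<mu> W"
        using m negligible_imp_measure0[OF negC] by linarith
    qed
  qed
  have bdd: "negligible T" if TS: "T \<subseteq> S" and "bounded T" for T
  proof -
    \<comment> \<open>\<open>s\<close> is the outer measure of \<open>T\<close>, taken over
      measurable covers of finite measure.\<close>
    define Q where "Q = ?\<mu> ` {V \<in> lmeasurable. T \<subseteq> V}"
    define s where "s = Inf Q"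
    obtain a b where "T \<subseteq> cbox a b" using \<open>bounded T\<close> bounded_subset_cbox_symmetric by blast
    then have Q: "Q \<noteq> {}" "bdd_below Q"
      unfolding Q_def by (auto intro!: bdd_belowI2[where m = 0])
    have s0: "s \<ge> 0" unfolding s_def using Q by (intro cInf_greatest) (auto simp: Q_def)
    \<comment> \<open>A cover is enlarged to an open set at a cost of \<open>e\<close> in measure,
      because the covering step starts from an open set.\<close>
    have *: "s \<le> c * (q + e)" if "q \<in> Q" "e > 0" for q e
    proof -
      obtain V where V: "V \<in> lmeasurable" "T \<subseteq> V" "q = ?\<mu> V" using \<open>q \<in> Q\<close> by (auto simp: Q_def)
      obtain W where W: "open W" "V \<subseteq> W" "W - V \<in> lmeasurable" "emeasure lebesgue (W - V) < ennreal e"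
        using sets_lebesgue_outer_open[OF _ \<open>e > 0\<close>] V(1) by (metis fmeasurableD)
      have "W = V \<union> (W - V)" using W(2) by auto
      then have Wm: "W \<in> lmeasurable" using V(1) W(3) by (metis fmeasurable.Un)
      have "?\<mu> (W - V) < e"
        using W(3,4) \<open>e > 0\<close> by (simp add: emeasure_eq_measure2 ennreal_less_iff)
      then have We: "?\<mu> W < ?\<mu> V + e"
        using measurable_measure_Diff[of W lebesgue V] Wm V(1) W(2) by auto
      obtain V' where V': "V' \<in> lmeasurable" "T \<subseteq> V'" "?\<mu> V' \<le> c * ?\<mu> W"
        using step[OF W(1) Wm _ TS] V W by blast
      have "s \<le> ?\<mu> V'" unfolding s_def using Q V' by (intro cInf_lower) (auto simp: Q_def)
      also have "\<dots> \<le> c * (q + e)"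
        using V' We V c mult_left_mono[of "?\<mu> W" "q + e" c] by linarith
      finally show ?thesis .
    qed
    have "s \<le> c * s + e" if "e > 0" for e
    proof -
      obtain q where q: "q \<in> Q" "q < s + e/2"
        using cInf_lessD[OF Q(1), of "s + e/2"] \<open>e > 0\<close> unfolding s_def by auto
      have "s \<le> c * (q + e/2)" using *[OF q(1), of "e/2"] \<open>e > 0\<close> by auto
      also have "\<dots> \<le> c * (s + e)" using q c by (intro mult_left_mono) auto
      also have "\<dots> \<le> c * s + e" using c \<open>e > 0\<close> by (auto simp: algebra_simps mult_left_le_one_le)
      finally show ?thesis .
    qed
    then have "s \<le> c * s" by (rule field_le_epsilon)
    then have "(1 - c) * s \<le> 0" by (simp add: algebra_simps)
    then have s: "s = 0" using c s0 by (simp add: mult_le_0_iff)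
    show ?thesis unfolding negligible_outer
    proof (intro allI impI)
      fix e :: real assume "e > 0"
      then obtain q where "q \<in> Q" "q < e"
        using cInf_lessD[OF Q(1), of e] s unfolding s_def by auto
      then show "\<exists>V. T \<subseteq> V \<and> V \<in> lmeasurable \<and> ?\<mu> V < e" by (auto simp: Q_def)
    qed
  qed
  have "S = (\<Union>n::nat. S \<inter> cball 0 (real n))"
    using real_arch_simple by auto
  moreover have "negligible (S \<inter> cball 0 (real n))" for n :: nat
    by (rule bdd) auto
  ultimately show ?thesis
    using negligible_countable_Union[of "range (\<lambda>n::nat. S \<inter> cball 0 (real n))"] by fastforce
qed

section \<open>Slopes of Lipschitz functions of one variable\<close>

text \<open>The increments are read as lengths of image intervals, which spares sorting the family.
  By continuity a common value of two images is attained at some \<open>u\<close>, and monotonicity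
  puts \<open>u\<close> into both intervals, against their disjointness.\<close>

lemma sum_increments_le:
  fixes G :: "real \<Rightarrow> real"
  assumes G: "mono G" "continuous_on UNIV G" and fin: "finite I" and ab: "\<alpha> \<le> \<beta>"
    and I: "\<And>p q. (p, q) \<in> I \<Longrightarrow> \<alpha> \<le> p \<and> p \<le> q \<and> q \<le> \<beta>"
    and disj: "pairwise (\<lambda>i j. disjnt {fst i..snd i} {fst j..snd j}) I"
  shows "(\<Sum>(p, q)\<in>I. G q - G p) \<le> G \<beta> - G \<alpha>"
proof -
  let ?J = "\<lambda>i. {G (fst i)<..<G (snd i)}"
  have between: "u \<in> {fst i..snd i}" if "G u \<in> ?J i" for u i
    using that monoD[OF G(1), of u "fst i"] monoD[OF G(1), of "snd i" u]
    by (auto simp: not_le[symmetric]) (meson linorder_le_cases not_le)+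
  have dj: "pairwise (\<lambda>i j. disjnt (?J i) (?J j)) I"
  proof (rule pairwiseI)
    fix i j assume ij: "i \<in> I" "j \<in> I" "i \<noteq> j"
    show "disjnt (?J i) (?J j)"
      unfolding disjnt_iff
    proof (intro allI notI, elim conjE)
      fix v assume v: "v \<in> ?J i" "v \<in> ?J j"
      obtain u where "G u = v"
        using IVT'[of G "fst i" v "snd i"] v ij I[of "fst i" "snd i"] continuous_on_subset[OF G(2)]
        by fastforce
      then show False
        using between[of u i] between[of u j] v ij disj unfolding pairwise_def disjnt_iff by blast
    qed
  qed
  have "(\<Sum>(p, q)\<in>I. G q - G p) = (\<Sum>i\<in>I. measure lebesgue (?J i))"
    
  proof (intro sum.cong refl, clarify)
    fix p q assume "(p, q) \<in> I"
    then have "G p \<le> G q" using I monoD[OF G(1)] by blast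
    then show "G q - G p = measure lebesgue (?J (p, q))" by simp
  qed
  also have "\<dots> = measure lebesgue (\<Union>i\<in>I. ?J i)"
    by (rule measure_UNION'[symmetric]) (use fin dj in auto)
  also have "\<dots> \<le> measure lebesgue {G \<alpha>..G \<beta>}"
  proof (rule measure_mono_fmeasurable)
    show "(\<Union>i\<in>I. ?J i) \<subseteq> {G \<alpha>..G \<beta>}"
    proof safe
      fix p q v assume "(p, q) \<in> I" "v \<in> ?J (p, q)"
      then show "v \<in> {G \<alpha>..G \<beta>}"
        using I[of p q] monoD[OF G(1), of \<alpha> p] monoD[OF G(1), of q \<beta>] by auto
    qed
  qed (use fin in auto)
  also have "\<dots> = G \<beta> - G \<alpha>" using ab G(1) by (auto dest: monoD)
  finally show ?thesis .
qed


text \<open>Adding \<open>K * u\<close> makes the function nondecreasing. A point of the set has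
  arbitrarily short intervals of slope below \<open>a + K\<close>, and the points of the set inside
  such an interval have tiny intervals of slope above \<open>b + K\<close>. The rises of disjoint
  tiny intervals fit into the rise of the large one, so they fill at most the fraction
  \<open>c\<close> of it; this is the gap required by \<open>negligible_density_gap\<close>.\<close>

lemma lipschitz_oscillating_slopes_negligible:
  fixes g :: "real \<Rightarrow> real"
  assumes g: "K-lipschitz_on UNIV g" and "a < b"
  shows "negligible {x. (\<forall>d>0. \<exists>t. 0 < \<bar>t\<bar> \<and> \<bar>t\<bar> < d \<and> (g (x + t) - g x) / t < a) \<and>
                        (\<forall>d>0. \<exists>t. 0 < \<bar>t\<bar> \<and> \<bar>t\<bar> < d \<and> b < (g (x + t) - g x) / t)}"
    (is "negligible ?S")
proof (cases "a + K \<le> 0")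
  case True
  have "?S = {}"
  proof (rule equals0I)
    fix x assume "x \<in> ?S"
    then obtain t where t: "0 < \<bar>t\<bar>" "(g (x + t) - g x) / t < a" using zero_less_one by blast
    have "\<bar>g (x + t) - g x\<bar> \<le> K * \<bar>t\<bar>"
      using lipschitz_onD[OF g, of "x + t" x] by (simp add: dist_real_def)
    then have "\<bar>(g (x + t) - g x) / t\<bar> \<le> K" using t by (simp add: field_simps)
    then show False using t True by linarith
  qed
  then show ?thesis by (simp only: negligible_empty)
next
  case False
  define G where "G u = g u + K * u" for u
  let ?\<mu> = "measure lebesgue"
  have G: "mono G"
  proof (rule monoI)
    fix x y :: real assume "x \<le> y"
    then show "G x \<le> G y"
      using lipschitz_onD[OF g, of x y] by (simp add: dist_real_def G_def algebra_simps)
  qed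
  have contG: "continuous_on UNIV G"
    unfolding G_def using lipschitz_on_continuous_on[OF g] by (intro continuous_intros)
  \<comment> \<open>Ordering the endpoints treats increments of both signs at once: the slope of
    \<open>G\<close> is that of \<open>g\<close> shifted by \<open>K\<close>.\<close>
  have slope: "(G (max x (x + t)) - G (min x (x + t))) / \<bar>t\<bar> = (g (x + t) - g x) / t + K" if "t \<noteq> 0" for x t
    using that by (cases "t > 0") (auto simp: G_def max_def min_def field_simps)
  define c where "c = (a + K) / (b + K)"
  have pos: "a + K > 0" "b + K > 0" using False \<open>a < b\<close> by auto
  have c: "0 \<le> c" "c < 1" using pos \<open>a < b\<close> by (auto simp: c_def)
  \<comment> \<open>The covering results speak of balls, which on the line are the closed
    intervals.\<close>
  have cball_Icc: "cball ((p + q) / 2) ((q - p) / 2) = {p..q}" for p q :: real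
    by (auto simp: dist_real_def abs_le_iff field_simps)
  show ?thesis
  proof (rule negligible_density_gap[OF c])
    fix x d :: real assume x: "x \<in> ?S" and d: "d > 0"
    then obtain t where t: "0 < \<bar>t\<bar>" "\<bar>t\<bar> < d" "(g (x + t) - g x) / t < a" by blast
    define \<alpha> \<beta> where "\<alpha> = min x (x + t)" and "\<beta> = max x (x + t)"
    have len: "\<beta> - \<alpha> = \<bar>t\<bar>" "\<alpha> < \<beta>" using t by (auto simp: \<alpha>_def \<beta>_def)
    have rise: "G \<beta> - G \<alpha> \<le> (a + K) * (\<beta> - \<alpha>)"
      
    proof -
      have "(G \<beta> - G \<alpha>) / \<bar>t\<bar> \<le> a + K"
        using slope[of t x] t unfolding \<alpha>_def \<beta>_def by simp
      then show ?thesis using t unfolding len by (simp add: divide_le_eq)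
    qed
    let ?K = "{(p, q). p < q \<and> \<alpha> < p \<and> q < \<beta> \<and> (b + K) * (q - p) \<le> G q - G p}"
    let ?I = "\<lambda>i. {fst i..snd i}"
    let ?a = "\<lambda>i. (fst i + snd i) / 2" and ?r = "\<lambda>i. (snd i - fst i) / 2"
    obtain C where "countable C" and Csub: "C \<subseteq> ?K"
      and pwC: "pairwise (\<lambda>i j. disjnt (?I i) (?I j)) C"
      and negC: "negligible (?S \<inter> {\<alpha><..<\<beta>} - (\<Union>i \<in> C. ?I i))"
      unfolding cball_Icc[symmetric]
    proof (rule Vitali_covering_theorem_cballs [of ?K ?r "?S \<inter> {\<alpha><..<\<beta>}" ?a])
      show "\<And>i. i \<in> ?K \<Longrightarrow> 0 < ?r i" by auto
    next
      fix y e :: real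
      assume y: "y \<in> ?S \<inter> {\<alpha><..<\<beta>}" and e: "e > 0"
      \<comment> \<open>The distances to \<open>\<alpha>\<close> and \<open>\<beta>\<close> keep the
        intervals of the Vitali family strictly inside the large one.\<close>
      define e' where "e' = min e (min (y - \<alpha>) (\<beta> - y))"
      have "e' > 0" using y e by (auto simp: e'_def)
      then obtain s where s: "0 < \<bar>s\<bar>" "\<bar>s\<bar> < e'" "b < (g (y + s) - g y) / s" using y by blast
      define p q where "p = min y (y + s)" and "q = max y (y + s)"
      have "(G q - G p) / \<bar>s\<bar> \<ge> b + K" using slope[of s y] s by (simp add: p_def q_def)
      moreover have "q - p = \<bar>s\<bar>" "p < q" using s by (auto simp: p_def q_def)
      ultimately have "(b + K) * (q - p) \<le> G q - G p" using s by (simp add: field_simps)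
      moreover have "\<alpha> < p" "q < \<beta>" using s by (auto simp: p_def q_def e'_def)
      moreover have "y \<in> {p..q}" by (auto simp: p_def q_def)
      moreover have "(q - p) / 2 < e" using \<open>q - p = \<bar>s\<bar>\<close> s e by (auto simp: e'_def)
      ultimately show "\<exists>i. i \<in> ?K \<and> y \<in> cball (?a i) (?r i) \<and> ?r i < e"
        using \<open>p < q\<close> unfolding cball_Icc by (intro exI[of _ "(p, q)"]) simp
    qed
    \<comment> \<open>The intervals in \<open>C\<close> have slopes of \<open>G\<close> at least \<open>b + K\<close>, but \<open>G\<close> rises at most
      \<open>(a + K) * (\<beta> - \<alpha>)\<close> between \<open>\<alpha>\<close> and \<open>\<beta>\<close>; so they leave a fixed fraction of it uncovered.\<close>
    have le: "?\<mu> (\<Union>i\<in>I. ?I i) \<le> c * (\<beta> - \<alpha>)" if I: "I \<subseteq> C" "finite I" for I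
    proof -
      have IK: "p < q \<and> \<alpha> < p \<and> q < \<beta> \<and> (b + K) * (q - p) \<le> G q - G p" if "(p, q) \<in> I" for p q
        using that I Csub by blast
      have pwI: "pairwise (\<lambda>i j. disjnt (?I i) (?I j)) I" using pwC I by (auto elim: pairwise_mono)
      have "(b + K) * ?\<mu> (\<Union>i\<in>I. ?I i) = (b + K) * (\<Sum>i\<in>I. ?\<mu> (?I i))"
        by (subst measure_UNION') (use I pwI in auto)
      also have "\<dots> = (\<Sum>(p, q)\<in>I. (b + K) * (q - p))"
        unfolding sum_distrib_left
      proof (intro sum.cong refl, clarify)
        fix p q assume "(p, q) \<in> I"
        then show "(b + K) * ?\<mu> (?I (p, q)) = (b + K) * (q - p)" using IK by fastforce
      qed
      also have "\<dots> \<le> (\<Sum>(p, q)\<in>I. G q - G p)"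
        by (intro sum_mono) (use IK in auto)
      also have "\<dots> \<le> G \<beta> - G \<alpha>"
        using IK len pwI by (intro sum_increments_le[OF G contG \<open>finite I\<close>]) (auto dest: IK intro: less_imp_le)
      also have "\<dots> \<le> (a + K) * (\<beta> - \<alpha>)" by (rule rise)
      finally show ?thesis using pos by (simp add: c_def field_simps)
    qed
    have m: "(\<Union>i\<in>C. ?I i) \<in> lmeasurable" "?\<mu> (\<Union>i\<in>C. ?I i) \<le> c * (\<beta> - \<alpha>)"
      using fmeasurable_UN_bound [OF \<open>countable C\<close> _ le] measure_UN_bound [OF \<open>countable C\<close> _ le]
      by auto
    \<comment> \<open>The endpoints are added because only the open interval was covered.\<close>
    define N where "N = (?S \<inter> {\<alpha><..<\<beta>} - (\<Union>i \<in> C. ?I i)) \<union> {\<alpha>, \<beta>}"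
    have N: "negligible N" unfolding N_def using negC by (intro negligible_Un) auto
    let ?U = "(\<Union>i\<in>C. ?I i) \<union> N"
    show "\<exists>m r U. 0 < r \<and> r < d \<and> x \<in> cball m r \<and> ?S \<inter> cball m r \<subseteq> U \<and>
        U \<in> lmeasurable \<and> ?\<mu> U \<le> c * ?\<mu> (cball m r)"
    proof (intro exI conjI)
      show "0 < (\<beta> - \<alpha>) / 2" "(\<beta> - \<alpha>) / 2 < d" using len t by auto
      show "x \<in> cball ((\<alpha> + \<beta>) / 2) ((\<beta> - \<alpha>) / 2)"
        unfolding cball_Icc by (auto simp: \<alpha>_def \<beta>_def)
      show "?S \<inter> cball ((\<alpha> + \<beta>) / 2) ((\<beta> - \<alpha>) / 2) \<subseteq> ?U"
        unfolding cball_Icc N_def by fastforce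
      show "?U \<in> lmeasurable" using m N by (simp add: fmeasurable.Un negligible_imp_measurable)
      have "?\<mu> ?U \<le> ?\<mu> (\<Union>i\<in>C. ?I i) + ?\<mu> N"
        using m N by (intro measure_Un_le) (auto simp: negligible_imp_sets)
      then show "?\<mu> ?U \<le> c * ?\<mu> (cball ((\<alpha> + \<beta>) / 2) ((\<beta> - \<alpha>) / 2))"
        unfolding cball_Icc using m negligible_imp_measure0[OF N] len by simp
    qed
  qed
qed

section \<open>Slopes along a fixed direction\<close>

text \<open>By translation invariance the measure of \<open>B\<close> shifted by
  \<open>t *\<^sub>R e\<close>, integrated over all \<open>t\<close>, is infinite unless
  \<open>B\<close> is null. Interchanging the integrals gives an integral over lines, which
  vanishes. No coordinate is split off, so \<open>e\<close> may be any vector.\<close>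

lemma negligible_if_lines_negligible:
  fixes B :: "'a::euclidean_space set"
  assumes B: "B \<in> sets borel" and lines: "\<And>x. negligible {t::real. x + t *\<^sub>R e \<in> B}"
  shows "negligible B"
proof -
  have line_sets: "{t::real. x + t *\<^sub>R e \<in> B} \<in> sets borel" for x
    using measurable_sets[of "\<lambda>t::real. x + t *\<^sub>R e" borel borel B] B
    by (simp add: vimage_def)
  have [measurable]: "B \<in> sets borel" by (rule B)
  have "emeasure lborel B * emeasure lborel (UNIV :: real set) =
      (\<integral>\<^sup>+ (t::real). emeasure lborel B \<partial>lborel)" by simp
  also have "\<dots> = (\<integral>\<^sup>+ (t::real). (\<integral>\<^sup>+ x. indicator B (x + t *\<^sub>R e) \<partial>lborel) \<partial>lborel)"
  proof (rule nn_integral_cong)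
    fix t :: real
    have "(\<integral>\<^sup>+ x. indicator B (x + t *\<^sub>R e) \<partial>lborel) = (\<integral>\<^sup>+ x. indicator B x \<partial>distr lborel borel (\<lambda>x. t *\<^sub>R e + x))"
      by (subst nn_integral_distr) (auto simp: add.commute)
    also have "\<dots> = emeasure lborel B"
      by (simp add: lborel_distr_plus)
    finally show "emeasure lborel B = (\<integral>\<^sup>+ x. indicator B (x + t *\<^sub>R e) \<partial>lborel)" ..
  qed
  also have "\<dots> = (\<integral>\<^sup>+ x. (\<integral>\<^sup>+ (t::real). indicator B (x + t *\<^sub>R e) \<partial>lborel) \<partial>lborel)"
    by (rule lborel_pair.Fubini'[symmetric]) measurable
  also have "\<dots> = (\<integral>\<^sup>+ (x::'a). 0 \<partial>lborel)"
  proof (rule nn_integral_cong)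
    fix x :: 'a
    have "(\<integral>\<^sup>+ (t::real). indicator B (x + t *\<^sub>R e) \<partial>lborel) =
        (\<integral>\<^sup>+ (t::real). indicator {t. x + t *\<^sub>R e \<in> B} t \<partial>lborel)"
      by (intro nn_integral_cong) (simp add: indicator_def)
    also have "\<dots> = emeasure lborel {t. x + t *\<^sub>R e \<in> B}"
      using line_sets[of x] by simp
    also have "\<dots> = emeasure lebesgue {t. x + t *\<^sub>R e \<in> B}"
      using line_sets[of x] by simp
    also have "\<dots> = 0" using lines[of x] by (simp add: negligible_iff_emeasure0 negligible_imp_sets)
    finally show "(\<integral>\<^sup>+ (t::real). indicator B (x + t *\<^sub>R e) \<partial>lborel) = 0" .
  qed
  finally have "emeasure lborel B = 0" by simp
  then show ?thesis using B by (simp add: negligible_iff_emeasure0)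
qed

text \<open>The one-dimensional result applies on every line in direction \<open>e\<close>. What
  remains is that the set is Borel, as the interchange of integrals requires.\<close>

lemma lipschitz_oscillating_directional_slopes_negligible:
  fixes f :: "'a::euclidean_space \<Rightarrow> real"
  assumes f: "K-lipschitz_on UNIV f" and "a < b"
  shows "negligible {x. (\<forall>d>0. \<exists>t. 0 < \<bar>t\<bar> \<and> \<bar>t\<bar> < d \<and> (f (x + t *\<^sub>R e) - f x) / t < a) \<and>
                        (\<forall>d>0. \<exists>t. 0 < \<bar>t\<bar> \<and> \<bar>t\<bar> < d \<and> b < (f (x + t *\<^sub>R e) - f x) / t)}"
    (is "negligible ?B")
proof (rule negligible_if_lines_negligible[where e = e])
  have cont: "continuous_on UNIV f" using f by (rule lipschitz_on_continuous_on)
  have cont_slope: "continuous_on UNIV (\<lambda>x. (f (x + t *\<^sub>R e) - f x) / t)" for t :: real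
    unfolding divide_inverse by (intro continuous_intros continuous_on_compose2[OF cont]) auto
  let ?P = "\<lambda>Q d x. \<exists>t. 0 < \<bar>t\<bar> \<and> \<bar>t\<bar> < d \<and> Q ((f (x + t *\<^sub>R e) - f x) / t)"
  \<comment> \<open>For fixed \<open>t\<close> the slope condition is open, hence so is its union
    over \<open>t\<close>; since the radii \<open>inverse (Suc n)\<close> suffice, the set is a
    countable intersection of open sets.\<close>
  have G_delta: "{x. \<forall>d>0. ?P Q d x} \<in> sets borel" if Q: "\<And>t::real. open {x. Q ((f (x + t *\<^sub>R e) - f x) / t)}" for Q
  proof -
    have "open {x. ?P Q d x}" for d
    proof -
      have "{x. ?P Q d x} = (\<Union>t\<in>{t. 0 < \<bar>t\<bar> \<and> \<bar>t\<bar> < d}. {x. Q ((f (x + t *\<^sub>R e) - f x) / t)})" by auto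
      then show ?thesis using Q by auto
    qed
    moreover have "{x. \<forall>d>0. ?P Q d x} = (\<Inter>n. {x. ?P Q (inverse (Suc n)) x})"
    proof (intro equalityI subsetI INT_I CollectI allI impI)
      fix x and d :: real assume x: "x \<in> (\<Inter>n. {x. ?P Q (inverse (Suc n)) x})" and "d > 0"
      obtain n where "inverse (real (Suc n)) < d" using reals_Archimedean[OF \<open>d > 0\<close>] by auto
      moreover have "?P Q (inverse (Suc n)) x" using x by blast
      ultimately show "?P Q d x" using less_trans by blast
    qed auto
    ultimately show ?thesis by auto
  qed
  have "?B = {x. \<forall>d>0. ?P (\<lambda>s. s < a) d x} \<inter> {x. \<forall>d>0. ?P (\<lambda>s. b < s) d x}" by auto
  also have "\<dots> \<in> sets borel"
    by (intro sets.Int G_delta open_Collect_less cont_slope continuous_on_const)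
  finally show "?B \<in> sets borel" .
  fix x
  define g where "g t = f (x + t *\<^sub>R e)" for t
  have "(K * norm e)-lipschitz_on UNIV g"
  proof (rule lipschitz_onI)
    show "dist (g s) (g t) \<le> K * norm e * dist s t" for s t
      using lipschitz_onD[OF f, of "x + s *\<^sub>R e" "x + t *\<^sub>R e"]
      by (simp add: g_def dist_norm flip: scaleR_diff_left) (simp add: mult_ac)
  qed (use lipschitz_on_nonneg[OF f] in simp)
  from lipschitz_oscillating_slopes_negligible[OF this \<open>a < b\<close>]
  show "negligible {t. x + t *\<^sub>R e \<in> ?B}"
    by (simp add: g_def algebra_simps)
qed

section \<open>Porous points\<close>

text \<open>A violating \<open>y\<close> near \<open>x\<close> is the centre of a hole of
  \<open>E\<close> in \<open>cball x ?r\<close>. The hole occupies the fraction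
  \<open>(\<eta> / (1 + \<eta>)) ^ DIM('a)\<close> of that ball at every scale, so the density
  criterion applies.\<close>

lemma porous_points_negligible:
  fixes E :: "'a::euclidean_space set"
  assumes "0 < \<eta>"
  shows "negligible {x \<in> E. \<not> (\<exists>r>0. \<forall>y. dist x y < r \<longrightarrow> (\<exists>z\<in>E. dist z y \<le> \<eta> * dist x y))}"
    (is "negligible ?P")
proof (rule negligible_density_gap)
  let ?\<mu> = "measure lebesgue"
  let ?c = "1 - (\<eta> / (1 + \<eta>)) ^ DIM('a)"
  show "0 \<le> ?c" using assms by (auto intro!: power_le_one simp: field_simps)
  show "?c < 1" using assms by simp
  fix x and d :: real assume x: "x \<in> ?P" and "d > 0"
  \<comment> \<open>The ball around \<open>x\<close> that contains the hole is larger than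
    \<open>dist x y\<close> by the factor \<open>1 + \<eta>\<close>, and its radius has to stay
    below \<open>d\<close>.\<close>
  then have "d / (1 + \<eta>) > 0" using assms by simp
  then obtain y where y: "dist x y < d / (1 + \<eta>)" "\<And>z. z \<in> E \<Longrightarrow> dist z y > \<eta> * dist x y"
    using x by (auto simp: not_le)
  define \<rho> where "\<rho> = dist x y"
  have "\<rho> > 0" using y(2)[of x] x unfolding \<rho>_def by (cases "x = y") auto
  let ?r = "(1 + \<eta>) * \<rho>"
  have sub: "cball y (\<eta> * \<rho>) \<subseteq> cball x ?r"

  proof
    fix z assume "z \<in> cball y (\<eta> * \<rho>)"
    then show "z \<in> cball x ?r"
      using dist_triangle[of x z y] by (simp add: \<rho>_def algebra_simps)
  qed
  show "\<exists>a r U. 0 < r \<and> r < d \<and> x \<in> cball a r \<and> ?P \<inter> cball a r \<subseteq> U \<and>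
      U \<in> lmeasurable \<and> ?\<mu> U \<le> ?c * ?\<mu> (cball a r)"
  proof (intro exI conjI)
    show r: "0 < ?r" using \<open>\<rho> > 0\<close> assms by (intro mult_pos_pos) auto
    show "?r < d" using assms y(1) by (simp add: \<rho>_def field_simps)
    show "x \<in> cball x ?r" using r by simp
    show "?P \<inter> cball x ?r \<subseteq> cball x ?r - cball y (\<eta> * \<rho>)"
      using y(2) by (fastforce simp: \<rho>_def dist_commute)
    show "cball x ?r - cball y (\<eta> * \<rho>) \<in> lmeasurable" by (intro fmeasurable.Diff) auto
    have "?\<mu> (cball x ?r - cball y (\<eta> * \<rho>)) = ?\<mu> (cball x ?r) - ?\<mu> (cball y (\<eta> * \<rho>))"
      using sub by (intro measurable_measure_Diff) auto
    also have "?\<mu> (cball y (\<eta> * \<rho>)) = (\<eta> / (1 + \<eta>)) ^ DIM('a) * ?\<mu> (cball x ?r)"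
      using content_ball_conv_unit_ball[of "\<eta> * \<rho>" y] content_ball_conv_unit_ball[of ?r x]
        \<open>\<rho> > 0\<close> assms by (simp add: content_cball_conv_ball power_divide power_mult_distrib)
    finally show "?\<mu> (cball x ?r - cball y (\<eta> * \<rho>)) \<le> ?c * ?\<mu> (cball x ?r)"
      by (simp add: algebra_simps)
  qed
qed

section \<open>From slopes to a derivative\<close>

text \<open>Take a level \<open>k * \<epsilon>\<close> that slopes exceed arbitrarily close to
  \<open>x\<close>, while they are eventually at most \<open>(k + 1) * \<epsilon>\<close>. Absence
  of oscillation one level lower keeps them eventually at least \<open>(k - 1) * \<epsilon>\<close>.
  Integer levels keep the number of null sets to be excluded countable.\<close>

lemma slope_between_grid_points:
  fixes f :: "'a::euclidean_space \<Rightarrow> real"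
  assumes f: "K-lipschitz_on UNIV f" and "\<epsilon> > 0" and "norm e = 1"
    and no_osc: "\<And>k::int. \<not> ((\<forall>d>0. \<exists>t. 0 < \<bar>t\<bar> \<and> \<bar>t\<bar> < d \<and> (f (x + t *\<^sub>R e) - f x) / t < k * \<epsilon>) \<and>
                        (\<forall>d>0. \<exists>t. 0 < \<bar>t\<bar> \<and> \<bar>t\<bar> < d \<and> (k + 1) * \<epsilon> < (f (x + t *\<^sub>R e) - f x) / t))"
  shows "\<exists>q d. 0 < d \<and> (\<forall>t. \<bar>t\<bar> < d \<longrightarrow> \<bar>f (x + t *\<^sub>R e) - f x - q * t\<bar> \<le> \<epsilon> * \<bar>t\<bar>)"
proof -
  let ?s = "\<lambda>t. (f (x + t *\<^sub>R e) - f x) / t"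
  have sK: "\<bar>?s t\<bar> \<le> K" if "t \<noteq> 0" for t
    using lipschitz_onD[OF f, of "x + t *\<^sub>R e" x] \<open>norm e = 1\<close> that
    by (simp add: dist_norm field_simps)
  define P where "P k \<longleftrightarrow> (\<exists>d>0. \<forall>t. 0 < \<bar>t\<bar> \<longrightarrow> \<bar>t\<bar> < d \<longrightarrow> ?s t \<le> of_int k * \<epsilon>)" for k :: int
  obtain M :: nat where M: "K < M * \<epsilon>" using reals_Archimedean3[OF \<open>\<epsilon> > 0\<close>] by blast
  have PM: "P (int M)"
    unfolding P_def using M sK by (intro exI[of _ 1]) (smt (verit) abs_zero of_int_of_nat_eq zero_less_one)
  have nPM: "\<not> P (- int M)"
  proof
    assume "P (- int M)"
    then obtain d where d: "d > 0" "\<And>t. 0 < \<bar>t\<bar> \<Longrightarrow> \<bar>t\<bar> < d \<Longrightarrow> ?s t \<le> of_int (- int M) * \<epsilon>"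
      unfolding P_def by blast
    have "?s (d / 2) \<le> of_int (- int M) * \<epsilon>" by (rule d(2)) (use d(1) in auto)
    moreover have "\<bar>?s (d / 2)\<bar> \<le> K" by (rule sK) (use d(1) in simp)
    ultimately show False using M unfolding of_int_minus of_int_of_nat_eq by linarith
  qed
  \<comment> \<open>\<open>P\<close> fails at \<open>- int M\<close> and holds at
    \<open>int M\<close>, so it switches in between.\<close>
  obtain k where k: "\<not> P k" "P (k + 1)"
  proof (rule ccontr)
    assume "\<not> thesis"
    then have step: "\<not> P k \<Longrightarrow> \<not> P (k + 1)" for k using that by blast
    have "\<not> P j" if "- int M \<le> j" for j
      using that by (induction j rule: int_ge_induct) (use nPM step in auto)
    from this[of "int M"] PM show False by simp
  qed
  from k(2) obtain d1 where d1: "d1 > 0" "\<And>t. 0 < \<bar>t\<bar> \<Longrightarrow> \<bar>t\<bar> < d1 \<Longrightarrow> ?s t \<le> of_int (k + 1) * \<epsilon>"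
    unfolding P_def by blast
  have "\<forall>d>0. \<exists>t. 0 < \<bar>t\<bar> \<and> \<bar>t\<bar> < d \<and> of_int k * \<epsilon> < ?s t"
    using k(1) unfolding P_def by (meson not_le)
  then have "\<not> (\<forall>d>0. \<exists>t. 0 < \<bar>t\<bar> \<and> \<bar>t\<bar> < d \<and> ?s t < of_int (k - 1) * \<epsilon>)"
    using no_osc[of "k - 1"] by simp
  then obtain d2 where d2: "d2 > 0" "\<And>t. 0 < \<bar>t\<bar> \<Longrightarrow> \<bar>t\<bar> < d2 \<Longrightarrow> of_int (k - 1) * \<epsilon> \<le> ?s t"
    by (meson not_le)
  show ?thesis
  proof (rule exI[of _ "of_int k * \<epsilon>"], rule exI[of _ "min d1 d2"], intro conjI allI impI)
    fix t :: real assume t: "\<bar>t\<bar> < min d1 d2"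
    show "\<bar>f (x + t *\<^sub>R e) - f x - of_int k * \<epsilon> * t\<bar> \<le> \<epsilon> * \<bar>t\<bar>"
    proof (cases "t = 0")
      case False
      then have "\<bar>?s t - of_int k * \<epsilon>\<bar> \<le> \<epsilon>"
        using d1(2)[of t] d2(2)[of t] t by (simp add: algebra_simps)
      then have "\<bar>?s t - of_int k * \<epsilon>\<bar> * \<bar>t\<bar> \<le> \<epsilon> * \<bar>t\<bar>" by (intro mult_right_mono) auto
      moreover have "(?s t - of_int k * \<epsilon>) * t = f (x + t *\<^sub>R e) - f x - of_int k * \<epsilon> * t"
        using False unfolding left_diff_distrib by simp
      ultimately show ?thesis by (simp flip: abs_mult)
    qed auto
  qed (use d1 d2 in auto)
qed

text \<open>The vector \<open>q\<close> may change with \<open>\<epsilon>\<close>. Two such vectors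
  approximate the same increments on a common ball, hence differ by at most the sum of the two
  errors; they form a Cauchy sequence whose limit is the gradient.\<close>

lemma differentiable_if_approximable_by_linear:
  fixes f :: "'a::euclidean_space \<Rightarrow> real"
  assumes approx: "\<And>\<epsilon>. \<epsilon> > 0 \<Longrightarrow> \<exists>q d. 0 < d \<and> (\<forall>h. norm h < d \<longrightarrow> \<bar>f (x + h) - f x - q \<bullet> h\<bar> \<le> \<epsilon> * norm h)"
  shows "f differentiable (at x)"
proof -
  let ?\<epsilon> = "\<lambda>n::nat. inverse (real (Suc n))"
  obtain q d where d: "\<And>n. 0 < d n"
    and q: "\<And>n h. norm h < d n \<Longrightarrow> \<bar>f (x + h) - f x - q n \<bullet> h\<bar> \<le> ?\<epsilon> n * norm h"
    using approx[of "?\<epsilon> n" for n] by (metis inverse_positive_iff_positive of_nat_0_less_iff zero_less_Suc)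
  have close: "norm (q m - q n) \<le> ?\<epsilon> m + ?\<epsilon> n" for m n
  proof (cases "q m = q n")
    case False
    define v where "v = q m - q n"
    \<comment> \<open>The increment \<open>s *\<^sub>R v\<close> points along the difference of the
      two vectors and has half the smaller radius as its norm, so both approximations apply to
      it.\<close>
    define s where "s = min (d m) (d n) / (2 * norm v)"
    have v: "norm v > 0" using False by (simp add: v_def)
    then have s: "s > 0" using d by (simp add: s_def)
    have "norm (s *\<^sub>R v) = min (d m) (d n) / 2" using v d[of m] d[of n] by (simp add: s_def)
    then have lt: "norm (s *\<^sub>R v) < d m" "norm (s *\<^sub>R v) < d n" using d[of m] d[of n] by linarith+
    have "s * (norm v * norm v) = q m \<bullet> (s *\<^sub>R v) - q n \<bullet> (s *\<^sub>R v)"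
      by (simp add: v_def dot_square_norm[symmetric] power2_eq_square[symmetric] flip: inner_diff_left right_diff_distrib)
    also have "\<dots> \<le> (?\<epsilon> m + ?\<epsilon> n) * norm (s *\<^sub>R v)"
      using q[OF lt(1)] q[OF lt(2)] unfolding distrib_right by linarith
    also have "\<dots> = s * ((?\<epsilon> m + ?\<epsilon> n) * norm v)" using s by simp
    finally show ?thesis using s v by (simp add: v_def[symmetric])
  qed auto
  have \<epsilon>0: "?\<epsilon> \<longlonglongrightarrow> 0" by (rule LIMSEQ_inverse_real_of_nat)
  have "Cauchy q"
  proof (rule metric_CauchyI)
    fix e :: real assume "e > 0"
    then obtain M where M: "\<And>n. n \<ge> M \<Longrightarrow> ?\<epsilon> n < e / 2"
      using order_tendstoD(2)[OF \<epsilon>0, of "e/2"] by (auto simp: eventually_sequentially)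
    then show "\<exists>M. \<forall>m\<ge>M. \<forall>n\<ge>M. dist (q m) (q n) < e"
      using close unfolding dist_norm by (intro exI[of _ M] allI impI) (smt (verit) field_sum_of_halves)
  qed
  then obtain p where p: "q \<longlonglongrightarrow> p" using Cauchy_convergent_iff convergent_def by blast
  have pq: "norm (q n - p) \<le> ?\<epsilon> n" for n
  proof (rule tendsto_le[OF trivial_limit_sequentially])
    show "(\<lambda>m. ?\<epsilon> n + ?\<epsilon> m) \<longlonglongrightarrow> ?\<epsilon> n" using tendsto_add[OF tendsto_const \<epsilon>0] by simp
    show "(\<lambda>m. norm (q n - q m)) \<longlonglongrightarrow> norm (q n - p)" by (intro tendsto_intros p)
  qed (use close in auto)
  have "(f has_derivative (\<lambda>h. p \<bullet> h)) (at x)"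
    unfolding has_derivative_at_alt
  proof (intro conjI allI impI)
    show "bounded_linear (\<lambda>h. p \<bullet> h)" by (rule bounded_linear_inner_right)
    fix e :: real assume "e > 0"
    then obtain n where n: "?\<epsilon> n < e / 2" using reals_Archimedean[of "e/2"] by auto
    show "\<exists>d>0. \<forall>y. norm (y - x) < d \<longrightarrow> norm (f y - f x - p \<bullet> (y - x)) \<le> e * norm (y - x)"
    proof (intro exI[of _ "d n"] conjI allI impI d)
      fix y assume y: "norm (y - x) < d n"
      have "\<bar>(q n - p) \<bullet> (y - x)\<bar> \<le> ?\<epsilon> n * norm (y - x)"
        using Cauchy_Schwarz_ineq2[of "q n - p" "y - x"] mult_right_mono[OF pq[of n], of "norm (y - x)"] by simp
      then have "\<bar>f y - f x - p \<bullet> (y - x)\<bar> \<le> (2 * ?\<epsilon> n) * norm (y - x)"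
        using q[OF y] by (simp add: inner_diff_left)
      also have "\<dots> \<le> e * norm (y - x)" using n by (intro mult_right_mono) auto
      finally show "norm (f y - f x - p \<bullet> (y - x)) \<le> e * norm (y - x)" by simp
    qed
  qed
  then show ?thesis by (auto simp: differentiable_def)
qed

text \<open>Walk from \<open>x\<close> to \<open>x + h\<close> one coordinate at a time, and take the slope of every step at a point
  of \<open>E\<close> close to its start.\<close>

lemma nonporous_partial_slopes_imp_linear_approx:
  fixes f :: "'a::euclidean_space \<Rightarrow> real" and K :: real
  assumes f: "K-lipschitz_on UNIV f" and "\<epsilon> > 0" and "\<delta> > 0"
    and E: "\<And>z e t. z \<in> E \<Longrightarrow> e \<in> Basis \<Longrightarrow> \<bar>t\<bar> < \<delta> \<Longrightarrow> \<bar>f (z + t *\<^sub>R e) - f z - (q \<bullet> e) * t\<bar> \<le> \<epsilon> * \<bar>t\<bar>"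
    and r: "r > 0" "\<And>y. dist x y < r \<Longrightarrow> \<exists>z\<in>E. dist z y \<le> \<epsilon> * dist x y"
    and h: "norm h < r" "norm h < \<delta>"
  shows "\<bar>f (x + h) - f x - q \<bullet> h\<bar> \<le> DIM('a) * ((1 + 2 * K) * \<epsilon>) * norm h"
proof -
  let ?y = "\<lambda>A. x + (\<Sum>e\<in>A. (h \<bullet> e) *\<^sub>R e)"
  have K: "K \<ge> 0" using f by (rule lipschitz_on_nonneg)
  have "\<bar>f (?y A) - f x - q \<bullet> (?y A - x)\<bar> \<le> card A * ((1 + 2 * K) * \<epsilon>) * norm h"
    if "finite A" "A \<subseteq> Basis" for A
    using that
  proof (induction A rule: finite_induct)
    case (insert e A)
    then have e: "e \<in> Basis" "A \<subseteq> Basis" by auto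
    define H where "H = norm h"
    \<comment> \<open>Partial sums in the orthonormal basis are no longer than \<open>h\<close>, so
      each intermediate point has a point of \<open>E\<close> within
      \<open>\<epsilon> * H\<close>.\<close>
    have "norm (?y A - x) \<le> H"
    proof -
      have "norm (?y A - x) ^ 2 = (\<Sum>e\<in>A. (h \<bullet> e)\<^sup>2)"
        using e insert(1) by (simp add: norm_sum_Pythagorean pairwise_def orthogonal_def inner_not_same_Basis subset_iff)
      also have "\<dots> \<le> (\<Sum>e\<in>Basis. (h \<bullet> e)\<^sup>2)" using e by (intro sum_mono2) auto
      also have "\<dots> = H\<^sup>2" by (simp add: H_def norm_eq_sqrt_inner euclidean_inner[of h h] power2_eq_square sum_nonneg)
      finally show ?thesis by (rule power2_le_imp_le) (simp add: H_def)
    qed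
    then have dy: "dist x (?y A) \<le> H" by (simp add: dist_norm norm_minus_commute)
    then obtain z where z: "z \<in> E" "dist z (?y A) \<le> \<epsilon> * dist x (?y A)"
      using r(2)[of "?y A"] h by (auto simp: H_def)
    then have dz: "dist z (?y A) \<le> \<epsilon> * H"
      using dy mult_left_mono[OF dy, of \<epsilon>] \<open>\<epsilon> > 0\<close> by linarith
    define t where "t = h \<bullet> e"
    have t: "\<bar>t\<bar> \<le> H" using Basis_le_norm[OF e(1), of h] by (simp add: t_def H_def)
    have yA: "?y (insert e A) = ?y A + t *\<^sub>R e" using insert(1,2) by (simp add: t_def algebra_simps)
    have "\<bar>f (z + t *\<^sub>R e) - f z - (q \<bullet> e) * t\<bar> \<le> \<epsilon> * H"
    proof (rule order_trans)
      show "\<bar>f (z + t *\<^sub>R e) - f z - (q \<bullet> e) * t\<bar> \<le> \<epsilon> * \<bar>t\<bar>"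
        using t h by (intro E[OF z(1) e(1)]) (simp add: H_def)
      show "\<epsilon> * \<bar>t\<bar> \<le> \<epsilon> * H" using t \<open>\<epsilon> > 0\<close> by (intro mult_left_mono) auto
    qed
    \<comment> \<open>Moving a step from \<open>?y A\<close> to \<open>z\<close> costs
      \<open>K * (\<epsilon> * H)\<close> at either end, whence the factor
      \<open>1 + 2 * K\<close>.\<close>
    moreover have "\<bar>f z - f (?y A)\<bar> \<le> K * (\<epsilon> * H)"
      using lipschitz_onD[OF f, of z "?y A"] mult_left_mono[OF dz K] by (simp add: dist_real_def)
    moreover have "\<bar>f (?y A + t *\<^sub>R e) - f (z + t *\<^sub>R e)\<bar> \<le> K * (\<epsilon> * H)"
      using lipschitz_onD[OF f, of "?y A + t *\<^sub>R e" "z + t *\<^sub>R e"] mult_left_mono[OF dz K]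
      by (simp add: dist_real_def dist_commute)
    moreover have "\<bar>f (?y A) - f x - q \<bullet> (?y A - x)\<bar> \<le> card A * ((1 + 2 * K) * \<epsilon>) * H"
      using insert.IH e by (simp add: H_def)
    moreover have "q \<bullet> (?y (insert e A) - x) = q \<bullet> (?y A - x) + (q \<bullet> e) * t"
      unfolding yA by (simp add: inner_add_right inner_diff_right)
    ultimately have "\<bar>f (?y (insert e A)) - f x - q \<bullet> (?y (insert e A) - x)\<bar>
        \<le> card A * ((1 + 2 * K) * \<epsilon>) * H + (\<epsilon> * H + 2 * (K * (\<epsilon> * H)))"
      unfolding yA by linarith
    also have "\<dots> = card (insert e A) * ((1 + 2 * K) * \<epsilon>) * H"
      using insert(1,2) by (simp add: algebra_simps)
    finally show ?case by (simp add: H_def)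
  qed simp
  from this[of Basis] show ?thesis by (simp add: euclidean_representation)
qed

section \<open>Differentiability almost everywhere\<close>

text \<open>The exceptional sets are indexed by basis vectors, grid levels and triples of
  \<open>q\<close> in a countable dense set and naturals \<open>m\<close>, \<open>n\<close>, so
  their union \<open>N\<close> is null. Off \<open>N\<close> the partial slopes are nearly those of
  some \<open>q\<close> in \<open>Q\<close>, which puts \<open>x\<close> into a set
  \<open>E q m n\<close>; as \<open>x\<close> is not porous for it, a linear approximation with
  error proportional to \<open>?\<epsilon> m\<close> follows.\<close>

theorem Rademacher_lipschitz:
  fixes f :: "'a::euclidean_space \<Rightarrow> real"
  assumes f: "K-lipschitz_on UNIV f"
  shows "negligible {x. \<not> f differentiable (at x)}"
proof -
  let ?\<epsilon> = "\<lambda>n::nat. inverse (real (Suc n))"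
  obtain Q :: "'a set" where Q: "countable Q" "\<And>T. open T \<Longrightarrow> T \<noteq> {} \<Longrightarrow> \<exists>q\<in>Q. q \<in> T"
    using countable_dense_setE by metis
  define osc where "osc e m k = {x. (\<forall>d>0. \<exists>t. 0 < \<bar>t\<bar> \<and> \<bar>t\<bar> < d \<and> (f (x + t *\<^sub>R e) - f x) / t < of_int k * ?\<epsilon> m) \<and>
      (\<forall>d>0. \<exists>t. 0 < \<bar>t\<bar> \<and> \<bar>t\<bar> < d \<and> (of_int k + 1) * ?\<epsilon> m < (f (x + t *\<^sub>R e) - f x) / t)}"
    for e m and k :: int
  define E where "E q m n = {x. \<forall>e\<in>Basis. \<forall>t. \<bar>t\<bar> < ?\<epsilon> n \<longrightarrow> \<bar>f (x + t *\<^sub>R e) - f x - (q \<bullet> e) * t\<bar> \<le> 2 * ?\<epsilon> m * \<bar>t\<bar>}"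
    for q m n
  define por where "por q m n = {x \<in> E q m n. \<not> (\<exists>r>0. \<forall>y. dist x y < r \<longrightarrow>
      (\<exists>z\<in>E q m n. dist z y \<le> 2 * ?\<epsilon> m * dist x y))}" for q m n
  define N where "N = (\<Union>(e, m, k) \<in> Basis \<times> UNIV \<times> UNIV. osc e m k) \<union> (\<Union>(q, m, n) \<in> Q \<times> UNIV \<times> UNIV. por q m n)"
  have "negligible (osc e m k)" for e m k
    unfolding osc_def by (rule lipschitz_oscillating_directional_slopes_negligible[OF f]) (simp add: distrib_right)
  moreover have "negligible (por q m n)" for q m n
    unfolding por_def by (rule porous_points_negligible) simp
  ultimately have "negligible N"
    unfolding N_def using Q(1)
    by (intro negligible_Un negligible_countable_Union countable_image countable_SIGMA countable_finite[OF finite_Basis]) auto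
  moreover have "f differentiable (at x)" if x: "x \<notin> N" for x
  proof (rule differentiable_if_approximable_by_linear)
    fix \<epsilon> :: real assume "\<epsilon> > 0"
    have K: "K \<ge> 0" using f by (rule lipschitz_on_nonneg)
    \<comment> \<open>The final error is \<open>2 * M * ?\<epsilon> m\<close> times
      \<open>norm h\<close>: one \<open>?\<epsilon> m\<close> comes from the grid of slopes, the
      other from choosing \<open>q\<close> in \<open>Q\<close>.\<close>
    define M where "M = DIM('a) * (1 + 2 * K)"
    have "M > 0" using K by (simp add: M_def add_pos_nonneg)
    then have "\<epsilon> / (2 * M) > 0" using \<open>\<epsilon> > 0\<close> by simp
    then obtain m where m: "?\<epsilon> m < \<epsilon> / (2 * M)" using reals_Archimedean by blast
    have "\<forall>e\<in>Basis. \<exists>q d. 0 < d \<and> (\<forall>t. \<bar>t\<bar> < d \<longrightarrow> \<bar>f (x + t *\<^sub>R e) - f x - q * t\<bar> \<le> ?\<epsilon> m * \<bar>t\<bar>)"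
    proof
      fix e :: 'a assume e: "e \<in> Basis"
      show "\<exists>q d. 0 < d \<and> (\<forall>t. \<bar>t\<bar> < d \<longrightarrow> \<bar>f (x + t *\<^sub>R e) - f x - q * t\<bar> \<le> ?\<epsilon> m * \<bar>t\<bar>)"
      proof (rule slope_between_grid_points[OF f])
        fix k
        have "x \<notin> osc e m k" using x e unfolding N_def by blast
        then show "\<not> ((\<forall>d>0. \<exists>t. 0 < \<bar>t\<bar> \<and> \<bar>t\<bar> < d \<and> (f (x + t *\<^sub>R e) - f x) / t < of_int k * ?\<epsilon> m) \<and>
            (\<forall>d>0. \<exists>t. 0 < \<bar>t\<bar> \<and> \<bar>t\<bar> < d \<and> (of_int k + 1) * ?\<epsilon> m < (f (x + t *\<^sub>R e) - f x) / t))"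
          unfolding osc_def mem_Collect_eq .
      qed (use e in auto)
    qed
    then obtain p d where d: "\<And>e. e \<in> Basis \<Longrightarrow> 0 < d e"
      and p: "\<And>e t. e \<in> Basis \<Longrightarrow> \<bar>t\<bar> < d e \<Longrightarrow> \<bar>f (x + t *\<^sub>R e) - f x - p e * t\<bar> \<le> ?\<epsilon> m * \<bar>t\<bar>"
      by metis
    obtain q where q: "q \<in> Q" "dist (\<Sum>e\<in>Basis. p e *\<^sub>R e) q < ?\<epsilon> m"
      using Q(2)[of "ball (\<Sum>e\<in>Basis. p e *\<^sub>R e) (?\<epsilon> m)"] by auto
    have pq: "\<bar>p e - q \<bullet> e\<bar> \<le> ?\<epsilon> m" if "e \<in> Basis" for e
      using Basis_le_norm[OF that, of "(\<Sum>e\<in>Basis. p e *\<^sub>R e) - q"] q(2) that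
      by (simp add: dist_norm inner_diff_left)
    have "Min (d ` Basis) > 0" using d by simp
    then obtain n where n: "?\<epsilon> n < Min (d ` Basis)" using reals_Archimedean by blast
    have xE: "x \<in> E q m n" unfolding E_def
    proof (intro CollectI ballI allI impI)
      fix e :: 'a and t :: real assume e: "e \<in> Basis" and t: "\<bar>t\<bar> < ?\<epsilon> n"
      then have "\<bar>t\<bar> < d e" using n by (smt (verit) Min_le finite_Basis finite_imageI image_eqI)
      from p[OF e this] have "\<bar>f (x + t *\<^sub>R e) - f x - p e * t\<bar> \<le> ?\<epsilon> m * \<bar>t\<bar>" .
      moreover have "\<bar>(p e - q \<bullet> e) * t\<bar> \<le> ?\<epsilon> m * \<bar>t\<bar>"
        unfolding abs_mult using pq[OF e] by (intro mult_right_mono) auto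
      ultimately show "\<bar>f (x + t *\<^sub>R e) - f x - (q \<bullet> e) * t\<bar> \<le> 2 * ?\<epsilon> m * \<bar>t\<bar>"
        by (simp add: left_diff_distrib)
    qed
    moreover have "x \<notin> por q m n" using x q(1) unfolding N_def by blast
    ultimately obtain r where r: "r > 0" "\<And>y. dist x y < r \<Longrightarrow> \<exists>z\<in>E q m n. dist z y \<le> 2 * ?\<epsilon> m * dist x y"
      unfolding por_def by blast
    show "\<exists>q d. 0 < d \<and> (\<forall>h. norm h < d \<longrightarrow> \<bar>f (x + h) - f x - q \<bullet> h\<bar> \<le> \<epsilon> * norm h)"
    proof (intro exI[of _ q] exI[of _ "min r (?\<epsilon> n)"] conjI allI impI)
      fix h :: 'a assume h: "norm h < min r (?\<epsilon> n)"
      have "\<bar>f (x + h) - f x - q \<bullet> h\<bar> \<le> DIM('a) * ((1 + 2 * K) * (2 * ?\<epsilon> m)) * norm h"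
        by (rule nonporous_partial_slopes_imp_linear_approx[OF f _ _ _ r, of "?\<epsilon> n"])
          (use h in \<open>auto simp: E_def\<close>)
      also have "\<dots> = (2 * M * ?\<epsilon> m) * norm h" by (simp add: M_def)
      also have "\<dots> \<le> \<epsilon> * norm h"
        using m \<open>M > 0\<close> by (intro mult_right_mono) (auto simp: field_simps)
      finally show "\<bar>f (x + h) - f x - q \<bullet> h\<bar> \<le> \<epsilon> * norm h" .
    qed (use r in auto)
  qed
  ultimately show ?thesis by (auto intro: negligible_subset)
qed

text \<open>The McShane extension.\<close>

lemma lipschitz_extension_real:
  fixes h :: "'a::metric_space \<Rightarrow> real"
  assumes h: "K-lipschitz_on S h" and "S \<noteq> {}"
  shows "\<exists>f. K-lipschitz_on UNIV f \<and> (\<forall>x\<in>S. f x = h x)"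
proof -
  define f where "f x = (INF y\<in>S. h y + K * dist x y)" for x
  have K: "K \<ge> 0" using h by (rule lipschitz_on_nonneg)
  have bdd: "bdd_below ((\<lambda>y. h y + K * dist x y) ` S)" for x
  proof -
    obtain y0 where "y0 \<in> S" using \<open>S \<noteq> {}\<close> by blast
    have "h y0 - K * dist x y0 \<le> h y + K * dist x y" if "y \<in> S" for y
    proof -
      have "h y0 - h y \<le> K * dist y0 y" using lipschitz_onD[OF h \<open>y0 \<in> S\<close> that] by (simp add: dist_real_def)
      also have "\<dots> \<le> K * (dist x y0 + dist x y)"
        using K dist_triangle[of y0 y x] by (intro mult_left_mono) (auto simp: dist_commute)
      finally show ?thesis by (simp add: algebra_simps)
    qed
    then show ?thesis by (rule bdd_belowI2)
  qed
  have "f x \<le> f x' + K * dist x x'" for x x'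
  proof -
    have "f x - K * dist x x' \<le> h y + K * dist x' y" if "y \<in> S" for y
    proof -
      have "f x \<le> h y + K * dist x y" unfolding f_def using bdd that by (rule cINF_lower)
      also have "K * dist x y \<le> K * (dist x x' + dist x' y)" using K by (intro mult_left_mono dist_triangle) auto
      finally show ?thesis by (simp add: algebra_simps)
    qed
    then have "f x - K * dist x x' \<le> f x'" unfolding f_def[of x'] using \<open>S \<noteq> {}\<close> by (intro cINF_greatest)
    then show ?thesis by simp
  qed
  note le = this
  have "K-lipschitz_on UNIV f"
  proof (rule lipschitz_onI[OF _ K])
    fix x y show "dist (f x) (f y) \<le> K * dist x y"
      using le[of x y] le[of y x] by (simp add: dist_real_def abs_le_iff dist_commute[of y x])
  qed
  moreover have "f x = h x" if "x \<in> S" for x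
  proof (rule antisym)
    show "f x \<le> h x" unfolding f_def using cINF_lower[OF bdd that, of x] by simp
    show "h x \<le> f x" unfolding f_def
    proof (rule cINF_greatest[OF \<open>S \<noteq> {}\<close>])
      fix y assume "y \<in> S"
      then show "h x \<le> h y + K * dist x y"
        using lipschitz_onD[OF h that \<open>y \<in> S\<close>] by (simp add: dist_real_def)
    qed
  qed
  ultimately show ?thesis by blast
qed

text \<open>Near each point \<open>h\<close> agrees on an open set with a globally Lipschitz
  extension and inherits its differentiability there. A set that is null near each of its points is
  null.\<close>

theorem Rademacher_locally_lipschitz:
  fixes h :: "'a::euclidean_space \<Rightarrow> real"
  assumes "open X"
    and h: "\<And>x. x \<in> X \<Longrightarrow> \<exists>e>0. \<exists>K. K-lipschitz_on (ball x e \<inter> X) h"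
  shows "negligible {x \<in> X. \<not> h differentiable (at x)}"
proof -
  let ?N = "{x \<in> X. \<not> h differentiable (at x)}"
  have "\<exists>V. openin (top_of_set ?N) V \<and> z \<in> V \<and> negligible V" if z: "z \<in> ?N" for z
  proof -
    obtain e K where e: "e > 0" "K-lipschitz_on (ball z e \<inter> X) h" using h z by blast
    have B: "open (ball z e \<inter> X)" "z \<in> ball z e \<inter> X" using e z \<open>open X\<close> by auto
    obtain f where f: "K-lipschitz_on UNIV f" "\<And>x. x \<in> ball z e \<inter> X \<Longrightarrow> f x = h x"
      using lipschitz_extension_real[OF e(2)] B by blast
    have "h differentiable (at x)" if "f differentiable (at x)" "x \<in> ball z e \<inter> X" for x
      using that B(1) f(2) unfolding differentiable_def
      by (meson has_derivative_transform_within_open)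
    then have "?N \<inter> (ball z e \<inter> X) \<subseteq> {x. \<not> f differentiable (at x)}" by auto
    then have "negligible (?N \<inter> (ball z e \<inter> X))"
      using Rademacher_lipschitz[OF f(1)] negligible_subset by blast
    then show ?thesis using B z by (intro exI[of _ "?N \<inter> (ball z e \<inter> X)"]) (auto simp: openin_open_Int)
  qed
  then show ?thesis unfolding locally_negligible_alt[of ?N] by blast
qed

section \<open>The Hamiltonian of a stationary solution\<close>

text \<open>One constant disturbance bounds the infimum over strategies. The time
  \<open>s = t\<close> lies in the half-open range because \<open>t < 0\<close>, and there every
  trajectory is at \<open>x\<close>.\<close>

lemma game_value_le_constraint:
  assumes adm: "admissible_system X U D F" and "x \<in> X" and "t < 0"
  shows "game_value X U D F l h0 x t \<le> ereal (l x)"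
proof -
  obtain d0 where "d0 \<in> D" using adm by (auto simp: admissible_system_def)
  then have \<delta>: "(\<lambda>_ _. d0) \<in> nonanticipative_strategies U D"
    by (auto simp: nonanticipative_strategies_def signals_def)
  have "(INF s\<in>{t..<0}. ereal (l (trajectory X F x t u (\<lambda>_. d0) s))) \<le> ereal (l x)"
    if u: "u \<in> signals U" for u
  proof -
    let ?\<xi> = "trajectory X F x t u (\<lambda>_. d0)"
    have "(\<lambda>_. d0) \<in> signals D" using \<open>d0 \<in> D\<close> by (auto simp: signals_def)
    then have "\<exists>\<xi>. solves_from X F x t u (\<lambda>_. d0) \<xi>"
      using adm \<open>x \<in> X\<close> u unfolding admissible_system_def by blast
    then have "solves_from X F x t u (\<lambda>_. d0) ?\<xi>"
      unfolding trajectory_def by (rule someI_ex)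
    \<comment> \<open>The integral over a single point vanishes, which forces the initial
      value.\<close>
    then have "((\<lambda>\<tau>. F (?\<xi> \<tau>) (u \<tau>) d0) has_integral (?\<xi> t - x)) {t..t}"
      unfolding solves_from_def by blast
    then have "?\<xi> t - x = 0"
      unfolding atLeastAtMost_singleton by (rule has_integral_unique) (rule has_integral_refl)
    then have "?\<xi> t = x" by simp
    then show ?thesis using \<open>t < 0\<close> by (intro INF_lower2[of t]) auto
  qed
  then have "(SUP u\<in>signals U. min (INF s\<in>{t..<0}. ereal (l (trajectory X F x t u (\<lambda>_. d0) s)))
      (ereal (h0 (trajectory X F x t u (\<lambda>_. d0) 0)))) \<le> ereal (l x)"
    by (intro SUP_least) (simp add: min.coboundedI1)
  then show ?thesis unfolding game_value_def by (rule INF_lower2[OF \<delta>])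
qed

lemma limit_value_le_constraint:
  assumes adm: "admissible_system X U D F" and conv: "value_converges_to X U D F l h0 hs" and "x \<in> X"
  shows "hs x \<le> l x"
proof -
  have "((\<lambda>t. game_value X U D F l h0 x t) \<longlongrightarrow> ereal (hs x)) at_bot"
    using conv \<open>x \<in> X\<close> by (simp add: value_converges_to_def)
  moreover have "\<forall>\<^sub>F t in at_bot. game_value X U D F l h0 x t \<le> ereal (l x)"
    using eventually_gt_at_bot[of 0]
    by (rule eventually_mono) (rule game_value_le_constraint[OF adm \<open>x \<in> X\<close>])
  ultimately have "ereal (hs x) \<le> ereal (l x)"
    by (rule tendsto_upperbound) simp
  then show ?thesis by simp
qed

section \<open>Paraboloids as test functions\<close>

text \<open>The paraboloid, extended constantly in time, serves as test function. Its time
  derivative is 0, so the second term of the minimum in \<open>vi_operator\<close> is the sup-inf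
  expression itself.\<close>

lemma touching_paraboloid_hamiltonian_nonneg:
  assumes visc: "stationary_viscosity_solution X U D F l h" and "y \<in> X" and "r > 0"
    and max: "\<And>z. z \<in> ball y r \<Longrightarrow> h z - q \<bullet> z - C * (norm (z - x))\<^sup>2 \<le> h y - q \<bullet> y - C * (norm (y - x))\<^sup>2"
  shows "0 \<le> (SUP u\<in>U. INF d\<in>D. (q + (2 * C) *\<^sub>R (y - x)) \<bullet> F y u d)"
proof -
  define \<phi> :: "(real^'a) \<times> real \<Rightarrow> real" where "\<phi> z = q \<bullet> fst z + C * (norm (fst z - x))\<^sup>2" for z
  define G :: "(real^'a) \<times> real \<Rightarrow> (real^'a) \<times> real" where "G z = (q + (2 * C) *\<^sub>R (fst z - x), 0)" for z
  have "GDERIV \<phi> z :> G z" for z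
    unfolding gderiv_def \<phi>_def G_def power2_norm_eq_inner
    by (auto intro!: derivative_eq_intros simp: fun_eq_iff inner_prod_def algebra_simps inner_commute)
  then have "C1_test_function (X \<times> {..<0}) \<phi> G"
    unfolding C1_test_function_def G_def by (auto intro!: continuous_intros)
  \<comment> \<open>Any negative time would do: the solution is stationary, so a local maximum in
    space is one in space and time.\<close>
  moreover have "\<forall>\<^sub>F z in at (y, -1::real). (case z of (z, t) \<Rightarrow> h z) - \<phi> z \<le> (case (y, -1::real) of (z, t) \<Rightarrow> h z) - \<phi> (y, -1)"
  proof -
    have "\<forall>\<^sub>F z in at (y, -1::real). fst z \<in> ball y r"
      using \<open>r > 0\<close> by (intro topological_tendstoD tendsto_eq_intros tendsto_ident_at) auto
    then show ?thesis
    proof (rule eventually_mono)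
      fix z :: "(real^'a) \<times> real" assume "fst z \<in> ball y r"
      from max[OF this] show "(case z of (z, t) \<Rightarrow> h z) - \<phi> z \<le> (case (y, -1::real) of (z, t) \<Rightarrow> h z) - \<phi> (y, -1)"
        by (simp add: \<phi>_def case_prod_unfold)
    qed
  qed
  moreover have "(-1::real) < 0" by simp
  ultimately have "0 \<le> vi_operator U D F l y (h y) (fst (G (y, -1))) (snd (G (y, -1)))"
    using visc \<open>y \<in> X\<close> unfolding stationary_viscosity_solution_def viscosity_solution_def by fastforce
  then show ?thesis by (simp add: vi_operator_def G_def)
qed

text \<open>Comparing the maximum with the value at \<open>x\<close> bounds the quadratic penalty by
  \<open>L + norm q\<close> times the distance to \<open>x\<close>. Dividing by the distance bounds
  the gradients of the penalty and gives the convergence.\<close>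

lemma penalized_maximizers:
  fixes h :: "'a::euclidean_space \<Rightarrow> real"
  assumes h: "L-lipschitz_on (cball x R) h" and "R > 0"
  shows "\<exists>y. y \<longlonglongrightarrow> x \<and>
    (\<forall>n. \<forall>z\<in>cball x R. h z - q \<bullet> z - Suc n * (norm (z - x))\<^sup>2 \<le> h (y n) - q \<bullet> y n - Suc n * (norm (y n - x))\<^sup>2) \<and>
    (\<forall>n. Suc n * norm (y n - x) \<le> L + norm q)"
proof -
  have "\<exists>y\<in>cball x R. \<forall>z\<in>cball x R. h z - q \<bullet> z - Suc n * (norm (z - x))\<^sup>2 \<le> h y - q \<bullet> y - Suc n * (norm (y - x))\<^sup>2" for n
    using lipschitz_on_continuous_on[OF h] \<open>R > 0\<close>
    by (intro continuous_attains_sup) (auto intro!: continuous_intros)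
  then obtain y where yR: "\<And>n. y n \<in> cball x R"
    and max: "\<And>n z. z \<in> cball x R \<Longrightarrow> h z - q \<bullet> z - Suc n * (norm (z - x))\<^sup>2 \<le> h (y n) - q \<bullet> y n - Suc n * (norm (y n - x))\<^sup>2"
    by metis
  have bound: "Suc n * norm (y n - x) \<le> L + norm q" for n
  proof (cases "y n = x")
    case True
    then show ?thesis using lipschitz_on_nonneg[OF h] by simp
  next
    case False
    have "Suc n * (norm (y n - x))\<^sup>2 \<le> (h (y n) - h x) - q \<bullet> (y n - x)"
      using max[of x n] \<open>R > 0\<close> by (simp add: inner_diff_right)
    also have "\<dots> \<le> L * norm (y n - x) + norm q * norm (y n - x)"
      using lipschitz_onD[OF h yR[of n], of x] \<open>R > 0\<close> Cauchy_Schwarz_ineq2[of q "y n - x"]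
      by (simp add: dist_norm)
    finally have "(Suc n * norm (y n - x)) * norm (y n - x) \<le> (L + norm q) * norm (y n - x)"
      by (simp add: power2_eq_square algebra_simps)
    then show ?thesis using False by simp
  qed
  have "(\<lambda>n. y n - x) \<longlonglongrightarrow> 0"
  proof (rule Lim_null_comparison)
    show "\<forall>\<^sub>F n in sequentially. norm (y n - x) \<le> (L + norm q) * inverse (real (Suc n))"
      using bound by (intro always_eventually allI) (simp add: field_simps)
    show "(\<lambda>n. (L + norm q) * inverse (real (Suc n))) \<longlonglongrightarrow> 0"
      using tendsto_mult[OF tendsto_const LIMSEQ_inverse_real_of_nat] by simp
  qed
  then have "y \<longlonglongrightarrow> x" by (simp add: LIM_zero_iff)
  then show ?thesis using max bound by blast
qed

section \<open>The Clarke gradient\<close>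

lemma clarke_dirderiv_le:
  assumes h: "K-lipschitz_on (ball x r) h" and "r > 0"
  shows "clarke_dirderiv h x v \<le> ereal (K * norm v)"
  unfolding clarke_dirderiv_def
proof (rule Limsup_bounded)
  have lim: "((\<lambda>z. fst z + snd z *\<^sub>R v) \<longlongrightarrow> x) (at (x, 0::real) within UNIV \<times> {0<..})"
    "(fst \<longlongrightarrow> x) (at (x, 0::real) within UNIV \<times> {0<..})"
    by (auto intro!: tendsto_eq_intros)
  have "\<forall>\<^sub>F z in at (x, 0::real) within UNIV \<times> {0<..}. fst z + snd z *\<^sub>R v \<in> ball x r"
    "\<forall>\<^sub>F z in at (x, 0::real) within UNIV \<times> {0<..}. fst z \<in> ball x r"
    using \<open>r > 0\<close> by (auto intro!: topological_tendstoD[OF lim(1)] topological_tendstoD[OF lim(2)] simp del: mem_ball)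
  moreover have "\<forall>\<^sub>F z in at (x, 0::real) within UNIV \<times> {0<..}. snd z > 0"
    by (auto simp: eventually_at_filter intro!: always_eventually)
  ultimately show "\<forall>\<^sub>F z in at (x, 0::real) within UNIV \<times> {0<..}.
      (case z of (y, s) \<Rightarrow> ereal ((h (y + s *\<^sub>R v) - h y) / s)) \<le> ereal (K * norm v)"
  proof eventually_elim
    case (elim z)
    have "h (fst z + snd z *\<^sub>R v) - h (fst z) \<le> K * (snd z * norm v)"
      using lipschitz_onD[OF h elim(1,2)] elim(3) by (simp add: dist_norm)
    then show ?case using elim(3) by (simp add: case_prod_unfold field_simps)
  qed
qed

text \<open>The bound comes from testing with \<open>v = p\<close>. It makes the real supremum over
  the Clarke gradient in \<open>lie_derivative\<close> bounded above, hence a genuine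
  supremum.\<close>

lemma clarke_gradient_bounded:
  assumes h: "K-lipschitz_on (ball x r) h" and "r > 0" and p: "p \<in> clarke_gradient h x"
  shows "norm p \<le> K"
proof (cases "p = 0")
  case False
  have "ereal (p \<bullet> p) \<le> ereal (K * norm p)"
    using p clarke_dirderiv_le[OF h \<open>r > 0\<close>, of p] unfolding clarke_gradient_def by (blast intro: order_trans)
  then show ?thesis using False by (simp add: dot_square_norm power2_eq_square)
qed (use lipschitz_on_nonneg[OF h] in simp)

text \<open>Comparing the maximum at \<open>y n\<close> with a nearby point in direction
  \<open>- v\<close> bounds a difference quotient of \<open>h\<close> from below by the paraboloid's
  slope, up to a curvature error. These quotients count in \<open>clarke_dirderiv\<close> because
  its upper limit also moves the base point.\<close>

lemma limit_of_paraboloid_gradients_in_clarke_gradient: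
  fixes h :: "'a::euclidean_space \<Rightarrow> real"
  assumes "R > 0" and y: "y \<longlonglongrightarrow> x" and p: "(\<lambda>n. (2 * C n) *\<^sub>R (y n - x)) \<longlonglongrightarrow> p"
    and C: "\<And>n. C n > 0" "filterlim C at_top sequentially"
    and max: "\<And>n z. z \<in> cball x R \<Longrightarrow> h z - C n * (norm (z - x))\<^sup>2 \<le> h (y n) - C n * (norm (y n - x))\<^sup>2"
  shows "p \<in> clarke_gradient h x"
  unfolding clarke_gradient_def
proof (intro CollectI allI)
  fix v
  let ?F = "at (x, 0::real) within UNIV \<times> {0<..}"
  let ?Q = "\<lambda>(y, s). ereal ((h (y + s *\<^sub>R v) - h y) / s)"
  \<comment> \<open>The base points \<open>y n - s n *\<^sub>R v\<close> witness the upper limit; the curvature term \<open>C n * s n\<close> has to vanish.\<close>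
  define s where "s n = inverse (C n) ^ 2" for n
  have s: "s n > 0" for n using C(1)[of n] by (simp add: s_def)
  have C0: "(\<lambda>n. inverse (C n)) \<longlonglongrightarrow> 0"
    using tendsto_inverse_0_at_top[OF C(2)] by simp
  have s0: "s \<longlonglongrightarrow> 0" unfolding s_def using tendsto_power[OF C0, of 2] by simp
  have base: "(\<lambda>n. y n - s n *\<^sub>R v) \<longlonglongrightarrow> x" using y s0 by (auto intro!: tendsto_eq_intros)
  have z: "filterlim (\<lambda>n. (y n - s n *\<^sub>R v, s n)) ?F sequentially"
    unfolding filterlim_at using s tendsto_Pair[OF base s0] by (auto simp: less_imp_neq[THEN not_sym])
  have lower: "\<forall>\<^sub>F n in sequentially. ((2 * C n) *\<^sub>R (y n - x)) \<bullet> v - inverse (C n) * (norm v)\<^sup>2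
      \<le> (h (y n) - h (y n - s n *\<^sub>R v)) / s n"
  proof -
    have "\<forall>\<^sub>F n in sequentially. y n - s n *\<^sub>R v \<in> ball x R"
      using \<open>R > 0\<close> by (intro topological_tendstoD[OF base]) auto
    then show ?thesis
    proof eventually_elim
      case (elim n)
      have Cs: "C n * s n = inverse (C n)" using less_imp_neq[OF C(1)[of n]] by (simp add: s_def power2_eq_square)
      have eq: "(norm (y n - s n *\<^sub>R v - x))\<^sup>2 = (norm (y n - x))\<^sup>2 - 2 * s n * ((y n - x) \<bullet> v) + (s n)\<^sup>2 * (norm v)\<^sup>2"
        unfolding power2_norm_eq_inner by (simp add: algebra_simps inner_commute power2_eq_square)
      have "C n * (2 * s n * ((y n - x) \<bullet> v) - (s n)\<^sup>2 * (norm v)\<^sup>2) \<le> h (y n) - h (y n - s n *\<^sub>R v)"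
        using max[of "y n - s n *\<^sub>R v" n] elim unfolding eq by (simp add: algebra_simps)
      moreover have "C n * (2 * s n * ((y n - x) \<bullet> v) - (s n)\<^sup>2 * (norm v)\<^sup>2)
          = (((2 * C n) *\<^sub>R (y n - x)) \<bullet> v - (C n * s n) * (norm v)\<^sup>2) * s n"
        by (simp add: algebra_simps power2_eq_square)
      ultimately show ?case using s[of n] unfolding Cs by (simp add: pos_le_divide_eq)
    qed
  qed
  show "ereal (p \<bullet> v) \<le> clarke_dirderiv h x v"
    unfolding clarke_dirderiv_def
  proof (rule ccontr)
    assume "\<not> ereal (p \<bullet> v) \<le> Limsup ?F ?Q"
    then have "Limsup ?F ?Q < ereal (p \<bullet> v)" unfolding not_le .
    then obtain a where a: "Limsup ?F ?Q < ereal a" "ereal a < ereal (p \<bullet> v)"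
      using ereal_dense2 by blast
    have "\<forall>\<^sub>F z in ?F. ?Q z < ereal a" using Limsup_lessD[OF a(1)] .
    then have "\<forall>\<^sub>F n in sequentially. ?Q (y n - s n *\<^sub>R v, s n) < ereal a"
      by (rule eventually_compose_filterlim[OF _ z])
    then have "\<forall>\<^sub>F n in sequentially. ((2 * C n) *\<^sub>R (y n - x)) \<bullet> v - inverse (C n) * (norm v)\<^sup>2 \<le> a"
      using lower by eventually_elim simp
    moreover have "(\<lambda>n. ((2 * C n) *\<^sub>R (y n - x)) \<bullet> v - inverse (C n) * (norm v)\<^sup>2) \<longlonglongrightarrow> p \<bullet> v - 0 * (norm v)\<^sup>2"
      by (intro tendsto_intros p C0)
    ultimately have "p \<bullet> v - 0 * (norm v)\<^sup>2 \<le> a" by (intro tendsto_upperbound) auto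
    then show False using a by simp
  qed
qed

section \<open>Limits of the sup-inf inequality\<close>

text \<open>This trades nested real suprema and infima for one control that works against all
  disturbances. The bound \<open>M\<close> makes the infimum over \<open>D\<close> a true lower
  bound rather than a default value.\<close>

lemma supinf_nonneg_imp_control:
  fixes F :: "'x \<Rightarrow> 'u \<Rightarrow> 'd \<Rightarrow> 'a::real_inner"
  assumes "U \<noteq> {}" and M: "\<And>u d. u \<in> U \<Longrightarrow> d \<in> D \<Longrightarrow> norm (F y u d) \<le> M"
    and "0 \<le> (SUP u\<in>U. INF d\<in>D. p \<bullet> F y u d)" and "\<epsilon> > 0"
  shows "\<exists>u\<in>U. \<forall>d\<in>D. p \<bullet> F y u d > - \<epsilon>"
proof -
  obtain u where u: "u \<in> U" "(INF d\<in>D. p \<bullet> F y u d) > - \<epsilon>"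
    using cSUP_least[OF \<open>U \<noteq> {}\<close>, of "\<lambda>u. INF d\<in>D. p \<bullet> F y u d" "- \<epsilon>"] assms(3) \<open>\<epsilon> > 0\<close> by force
  have "bdd_below ((\<lambda>d. p \<bullet> F y u d) ` D)"
  proof (rule bdd_belowI2)
    fix d assume "d \<in> D"
    have "\<bar>p \<bullet> F y u d\<bar> \<le> norm p * M"
      using Cauchy_Schwarz_ineq2[of p "F y u d"] mult_left_mono[OF M[OF u(1) \<open>d \<in> D\<close>], of "norm p"] by simp
    then show "- (norm p * M) \<le> p \<bullet> F y u d" by simp
  qed
  then have "(INF d\<in>D. p \<bullet> F y u d) \<le> p \<bullet> F y u d" if "d \<in> D" for d using that by (rule cINF_lower)
  then show ?thesis using u by force
qed

text \<open>A single large \<open>n\<close> suffices: \<open>p n \<bullet> F (y n) u d\<close>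
  exceeds \<open>q \<bullet> F x u d\<close> by less than \<open>\<epsilon> / 2\<close> uniformly in
  \<open>u\<close> and \<open>d\<close>, so the control found at \<open>y n\<close> serves at
  \<open>x\<close> and no limit of controls is taken.\<close>

lemma supinf_nonneg_limit:
  fixes F :: "'x::real_normed_vector \<Rightarrow> 'u \<Rightarrow> 'd \<Rightarrow> 'a::real_inner"
  assumes "U \<noteq> {}" and "x \<in> X"
    and M: "\<And>y u d. y \<in> X \<Longrightarrow> u \<in> U \<Longrightarrow> d \<in> D \<Longrightarrow> norm (F y u d) \<le> M"
    and K: "\<And>u d. u \<in> U \<Longrightarrow> d \<in> D \<Longrightarrow> K-lipschitz_on X (\<lambda>x. F x u d)"
    and y: "y \<longlonglongrightarrow> x" and p: "p \<longlonglongrightarrow> q"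
    and ev: "\<forall>\<^sub>F n in sequentially. y n \<in> X \<and> 0 \<le> (SUP u\<in>U. INF d\<in>D. p n \<bullet> F (y n) u d)"
    and "\<epsilon> > 0"
  shows "\<exists>u\<in>U. \<forall>d\<in>D. q \<bullet> F x u d > - \<epsilon>"
proof -
  have "(\<lambda>n. norm (p n - q) * M + norm q * (K * dist x (y n))) \<longlonglongrightarrow> norm (q - q) * M + norm q * (K * dist x x)"
    by (intro tendsto_intros p y)
  then have "\<forall>\<^sub>F n in sequentially. norm (p n - q) * M + norm q * (K * dist x (y n)) < \<epsilon> / 2"
    using \<open>\<epsilon> > 0\<close> by (intro order_tendstoD(2)) auto
  from eventually_happens[OF eventually_conj[OF this ev]] obtain n where
    n: "norm (p n - q) * M + norm q * (K * dist x (y n)) < \<epsilon> / 2" and yX: "y n \<in> X"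
    and pos: "0 \<le> (SUP u\<in>U. INF d\<in>D. p n \<bullet> F (y n) u d)" by auto
  obtain u where u: "u \<in> U" "\<And>d. d \<in> D \<Longrightarrow> p n \<bullet> F (y n) u d > - (\<epsilon> / 2)"
    using supinf_nonneg_imp_control[where F = F and y = "y n", OF \<open>U \<noteq> {}\<close> M[OF yX] pos, of "\<epsilon> / 2"] \<open>\<epsilon> > 0\<close> by auto
  have "q \<bullet> F x u d > - \<epsilon>" if d: "d \<in> D" for d
  proof -
    have "p n \<bullet> F (y n) u d - q \<bullet> F x u d = (p n - q) \<bullet> F (y n) u d + q \<bullet> (F (y n) u d - F x u d)"
      by (simp add: algebra_simps)
    also have "\<dots> \<le> norm (p n - q) * norm (F (y n) u d) + norm q * norm (F (y n) u d - F x u d)"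
      by (intro add_mono norm_cauchy_schwarz)
    also have "\<dots> \<le> norm (p n - q) * M + norm q * (K * dist x (y n))"
      using M[OF yX u(1) d] lipschitz_onD[OF K[OF u(1) d] yX \<open>x \<in> X\<close>]
      by (intro add_mono mult_left_mono) (auto simp: dist_norm norm_minus_commute)
    finally show ?thesis using n u(2)[OF d] by linarith
  qed
  then show ?thesis using u(1) by blast
qed

text \<open>A control that works against every disturbance leads from the sup-inf of the variational
  inequality to the inf-sup of \<open>lie_hamiltonian\<close>. The vector \<open>p\<close> stands
  for the gradient or for an element of the Clarke gradient; the bound \<open>B\<close> makes the
  suprema over \<open>U\<close> genuine.\<close>

lemma lie_hamiltonian_nonneg_if_lie_derivative_ge:
  assumes "D \<noteq> {}"
    and ge: "\<And>u d. u \<in> U \<Longrightarrow> d \<in> D \<Longrightarrow> p \<bullet> F x u d \<le> lie_derivative F h x u d"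
    and bdd: "\<And>u d. u \<in> U \<Longrightarrow> d \<in> D \<Longrightarrow> lie_derivative F h x u d \<le> B"
    and control: "\<And>\<epsilon>. \<epsilon> > 0 \<Longrightarrow> \<exists>u\<in>U. \<forall>d\<in>D. p \<bullet> F x u d > - \<epsilon>"
  shows "0 \<le> lie_hamiltonian U D F h x"
  unfolding lie_hamiltonian_def
proof (rule cINF_greatest[OF \<open>D \<noteq> {}\<close>], rule field_le_epsilon)
  fix d and \<epsilon> :: real assume d: "d \<in> D" and "\<epsilon> > 0"
  obtain u where u: "u \<in> U" "p \<bullet> F x u d > - \<epsilon>" using control[OF \<open>\<epsilon> > 0\<close>] d by blast
  have "bdd_above ((\<lambda>u. lie_derivative F h x u d) ` U)"
    by (rule bdd_aboveI2) (rule bdd[OF _ d])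
  then have "lie_derivative F h x u d \<le> (SUP u\<in>U. lie_derivative F h x u d)"
    using u(1) by (intro cSUP_upper)
  then show "0 \<le> (SUP u\<in>U. lie_derivative F h x u d) + \<epsilon>" using u ge[OF u(1) d] by linarith
qed

section \<open>The sign of the Hamiltonian\<close>

lemma lie_hamiltonian_nonneg:
  fixes h :: "real^'n \<Rightarrow> real"
  assumes adm: "admissible_system X U D F" and visc: "stationary_viscosity_solution X U D F l h"
    and h: "locally_lipschitz_on X h" and x: "x \<in> X"
  shows "0 \<le> lie_hamiltonian U D F h x"
proof -
  have "open X" and U: "U \<noteq> {}" and D: "D \<noteq> {}" using adm by (auto simp: admissible_system_def)
  obtain M where M: "\<And>y u d. y \<in> X \<Longrightarrow> u \<in> U \<Longrightarrow> d \<in> D \<Longrightarrow> norm (F y u d) \<le> M"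
    using adm unfolding admissible_system_def bounded_iff by fastforce
  obtain K where K: "\<And>u d. u \<in> U \<Longrightarrow> d \<in> D \<Longrightarrow> K-lipschitz_on X (\<lambda>x. F x u d)"
    using adm unfolding admissible_system_def by blast
  obtain e L where e: "e > 0" "L-lipschitz_on (ball x e \<inter> X) h"
    using h x unfolding locally_lipschitz_on_def by blast
  have "open (ball x e \<inter> X)" "x \<in> ball x e \<inter> X" using e x \<open>open X\<close> by auto
  then obtain R where R: "R > 0" "cball x R \<subseteq> ball x e \<inter> X" by (meson open_contains_cball)
  have L: "L-lipschitz_on (cball x R) h" using e(2) R(2) by (rule lipschitz_on_subset)
  have L': "L-lipschitz_on (ball x R) h" using L ball_subset_cball by (rule lipschitz_on_subset)
  \<comment> \<open>Maximizers over the closed ball eventually lie in its interior, where they are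
    local maxima and the paraboloid is a valid test function.\<close>
  have ham: "\<forall>\<^sub>F n in sequentially. y n \<in> X \<and>
      0 \<le> (SUP u\<in>U. INF d\<in>D. (q + (2 * real (Suc n)) *\<^sub>R (y n - x)) \<bullet> F (y n) u d)"
    if y: "y \<longlonglongrightarrow> x"
      and max: "\<forall>n. \<forall>z\<in>cball x R. h z - q \<bullet> z - Suc n * (norm (z - x))\<^sup>2 \<le> h (y n) - q \<bullet> y n - Suc n * (norm (y n - x))\<^sup>2"
    for y q
  proof -
    have "\<forall>\<^sub>F n in sequentially. y n \<in> ball x R" using y R(1) by (intro topological_tendstoD) auto
    then show ?thesis
    proof eventually_elim
      case (elim n)
      obtain r where "r > 0" "ball (y n) r \<subseteq> ball x R" using elim open_ball openE by blast
      then have sub: "ball (y n) r \<subseteq> cball x R" using ball_subset_cball by blast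
      have "y n \<in> X" using elim R(2) ball_subset_cball by blast
      moreover have "h z - q \<bullet> z - Suc n * (norm (z - x))\<^sup>2 \<le> h (y n) - q \<bullet> y n - Suc n * (norm (y n - x))\<^sup>2"
        if "z \<in> ball (y n) r" for z using max sub that by blast
      ultimately show ?case
        using touching_paraboloid_hamiltonian_nonneg[OF visc _ \<open>r > 0\<close>] by blast
    qed
  qed
  show ?thesis
  proof (cases "h differentiable (at x)")
    case True
    define q where "q = adjoint (frechet_derivative h (at x)) 1"
    have lin: "linear (frechet_derivative h (at x))" using True by (rule linear_frechet_derivative)
    have q: "frechet_derivative h (at x) v = q \<bullet> v" for v
      using adjoint_works[OF lin, of v 1] by (simp add: q_def inner_commute)
    have deriv: "(h has_derivative (\<lambda>v. q \<bullet> v)) (at x)"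
      using True unfolding frechet_derivative_works q .
    obtain y where y: "y \<longlonglongrightarrow> x"
      and max: "\<forall>n. \<forall>z\<in>cball x R. h z - q \<bullet> z - Suc n * (norm (z - x))\<^sup>2 \<le> h (y n) - q \<bullet> y n - Suc n * (norm (y n - x))\<^sup>2"
      using penalized_maximizers[OF L R(1), of q] by blast
    \<comment> \<open>Comparison with \<open>x\<close> bounds the penalty by the remainder of the
      first-order expansion, which is small relative to \<open>norm (y n - x)\<close>. The fraction
      \<open>\<epsilon> / 3\<close> absorbs the factor 2 and leaves a strict inequality.\<close>
    have "(\<lambda>n. (2 * real (Suc n)) *\<^sub>R (y n - x)) \<longlonglongrightarrow> 0"
    proof (rule tendstoI)
      fix \<epsilon> :: real assume "\<epsilon> > 0"
      then have "\<epsilon> / 3 > 0" by simp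
      then obtain d where d: "d > 0" "\<And>z. norm (z - x) < d \<Longrightarrow> norm (h z - h x - q \<bullet> (z - x)) \<le> \<epsilon> / 3 * norm (z - x)"
        using deriv unfolding has_derivative_at_alt by blast
      have "\<forall>\<^sub>F n in sequentially. dist (y n) x < d" using y d(1) by (rule tendstoD)
      then show "\<forall>\<^sub>F n in sequentially. dist ((2 * real (Suc n)) *\<^sub>R (y n - x)) 0 < \<epsilon>"
      proof eventually_elim
        case (elim n)
        have "Suc n * (norm (y n - x))\<^sup>2 \<le> h (y n) - h x - q \<bullet> (y n - x)"
          using max[rule_format, of x n] R(1) by (simp add: inner_diff_right)
        also have "\<dots> \<le> \<epsilon> / 3 * norm (y n - x)" using d(2)[OF elim[unfolded dist_norm]] unfolding real_norm_def by linarith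
        finally have "(Suc n * norm (y n - x)) * norm (y n - x) \<le> \<epsilon> / 3 * norm (y n - x)"
          by (simp add: power2_eq_square mult.assoc)
        then have "Suc n * norm (y n - x) \<le> \<epsilon> / 3" using \<open>\<epsilon> > 0\<close> by (cases "y n = x") auto
        then have "2 * (Suc n * norm (y n - x)) < \<epsilon>" using \<open>\<epsilon> > 0\<close> by linarith
        then show ?case by (simp add: ring_distribs)
      qed
    qed
    from tendsto_add[OF tendsto_const[of q] this]
    have p: "(\<lambda>n. q + (2 * real (Suc n)) *\<^sub>R (y n - x)) \<longlonglongrightarrow> q" by simp
    have lie: "lie_derivative F h x u d = q \<bullet> F x u d" for u d
      using True by (simp add: lie_derivative_def q)
    show ?thesis
    proof (rule lie_hamiltonian_nonneg_if_lie_derivative_ge[OF D])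
      fix \<epsilon> :: real assume "\<epsilon> > 0"
      then show "\<exists>u\<in>U. \<forall>d\<in>D. q \<bullet> F x u d > - \<epsilon>"
        using supinf_nonneg_limit[OF U x M K y p ham[OF y max]] by blast
    next
      fix u d assume "u \<in> U" "d \<in> D"
      then show "lie_derivative F h x u d \<le> norm q * M"
        unfolding lie using norm_cauchy_schwarz[of q "F x u d"] mult_left_mono[OF M[OF x], of u d "norm q"] by force
    qed (simp add: lie)
  next
    case False
    obtain y where y: "y \<longlonglongrightarrow> x"
      and max: "\<forall>n. \<forall>z\<in>cball x R. h z - 0 \<bullet> z - Suc n * (norm (z - x))\<^sup>2 \<le> h (y n) - 0 \<bullet> y n - Suc n * (norm (y n - x))\<^sup>2"
      and bound: "\<forall>n. Suc n * norm (y n - x) \<le> L + norm (0::real^'n)"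
      using penalized_maximizers[OF L R(1), of 0] by blast
    define P where "P n = (2 * real (Suc n)) *\<^sub>R (y n - x)" for n
    have "bounded (range P)"
      unfolding bounded_iff
    proof (intro exI[of _ "2 * L"] ballI, elim rangeE, simp only:)
      fix n
      have "norm (P n) = 2 * (Suc n * norm (y n - x))" by (simp add: P_def ring_distribs)
      then show "norm (P n) \<le> 2 * L" using bound[rule_format, of n] unfolding norm_zero by linarith
    qed
    then obtain p r where r: "strict_mono r" and p: "(P \<circ> r) \<longlonglongrightarrow> p"
      using bounded_imp_convergent_subsequence by blast
    have yr: "(\<lambda>n. y (r n)) \<longlonglongrightarrow> x" using LIMSEQ_subseq_LIMSEQ[OF y r] by (simp add: o_def)
    have clarke: "p \<in> clarke_gradient h x"
    proof (rule limit_of_paraboloid_gradients_in_clarke_gradient[OF R(1) yr, where C = "\<lambda>n. real (Suc (r n))"])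
      show "(\<lambda>n. (2 * real (Suc (r n))) *\<^sub>R (y (r n) - x)) \<longlonglongrightarrow> p" using p by (simp add: P_def o_def)
      show "filterlim (\<lambda>n. real (Suc (r n))) at_top sequentially"
        by (intro filterlim_compose[OF filterlim_real_sequentially] filterlim_compose[OF filterlim_Suc]
            filterlim_subseq r)
    qed (use max in auto)
    have pF: "p' \<bullet> F x u d \<le> L * M" if "p' \<in> clarke_gradient h x" "u \<in> U" "d \<in> D" for p' u d
    proof -
      have "p' \<bullet> F x u d \<le> norm p' * norm (F x u d)" by (rule norm_cauchy_schwarz)
      also have "\<dots> \<le> L * M"
        using clarke_gradient_bounded[OF L' R(1) that(1)] M[OF x that(2,3)] lipschitz_on_nonneg[OF L]
        by (intro mult_mono) auto
      finally show ?thesis .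
    qed
    have lie: "lie_derivative F h x u d = (SUP p\<in>clarke_gradient h x. p \<bullet> F x u d)" for u d
      using False by (simp add: lie_derivative_def)
    show ?thesis
    proof (rule lie_hamiltonian_nonneg_if_lie_derivative_ge[OF D])
      fix \<epsilon> :: real assume "\<epsilon> > 0"
      have ev: "\<forall>\<^sub>F n in sequentially. y (r n) \<in> X \<and>
          0 \<le> (SUP u\<in>U. INF d\<in>D. (P \<circ> r) n \<bullet> F (y (r n)) u d)"
        using eventually_subseq[OF r ham[OF y max]] by (simp add: P_def)
      show "\<exists>u\<in>U. \<forall>d\<in>D. p \<bullet> F x u d > - \<epsilon>"
        using supinf_nonneg_limit[OF U x M K yr p ev \<open>\<epsilon> > 0\<close>] by blast
    next
      fix u d assume ud: "u \<in> U" "d \<in> D"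
      show "lie_derivative F h x u d \<le> L * M"
        unfolding lie using clarke pF ud by (intro cSUP_least) auto
      show "p \<bullet> F x u d \<le> lie_derivative F h x u d"
        unfolding lie using clarke pF[OF _ ud] by (intro cSUP_upper bdd_aboveI2) auto
    qed
  qed
qed

theorem theorem1:
  fixes X L :: "(real^'n) set" and U :: "(real^'m) set" and D :: "(real^'o) set"
    and f :: "real^'n \<Rightarrow> real^'n" and g :: "real^'n \<Rightarrow> real^'m^'n" and w :: "real^'n \<Rightarrow> real^'o^'n"
    and l h0 hs :: "real^'n \<Rightarrow> real"
  assumes "admissible_system X U D (control_affine f g w)"
    and "L \<subseteq> X" and "\<forall>x\<in>X. l x \<ge> 0 \<longleftrightarrow> x \<in> L"
    and "\<forall>x\<in>X. h0 x \<le> l x"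
    and "locally_lipschitz_on X hs"
    and "value_converges_to X U D (control_affine f g w) l h0 hs"
  shows "safe_cbvf_on X U D (control_affine f g w) L hs {x\<in>X. hs x \<ge> 0}"
proof -
  let ?F = "control_affine f g w"
  have H: "0 \<le> lie_hamiltonian U D ?F hs x" if "x \<in> X" for x
    using assms(1,5,6) that by (auto simp: value_converges_to_def intro: lie_hamiltonian_nonneg)
  have "open X" using assms(1) by (simp add: admissible_system_def)
  then have "negligible {x \<in> X. \<not> hs differentiable (at x)}"
    using assms(5) by (intro Rademacher_locally_lipschitz) (auto simp: locally_lipschitz_on_def)
  then have "AE x in lebesgue. x \<in> X \<longrightarrow> hs differentiable (at x)"
    by (intro AE_I'[of "{x \<in> X. \<not> hs differentiable (at x)}"]) (auto simp: negligible_iff_null_sets)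
  \<comment> \<open>On this set \<open>hs\<close> is nonnegative, so the right-hand side is at most
    0; the value 1 is an arbitrary choice.\<close>
  moreover have "\<exists>\<gamma>>0. \<forall>x\<in>{x\<in>X. hs x \<ge> 0}. lie_hamiltonian U D ?F hs x \<ge> - (\<gamma> * hs x)"
    using H by (intro exI[of _ 1]) force
  moreover have "{x\<in>X. hs x \<ge> 0} \<subseteq> L"
    using limit_value_le_constraint[OF assms(1,6)] assms(3) by force
  ultimately show ?thesis
    using H by (auto simp: safe_cbvf_on_def cbvf_on_def safe_value_function_def)
qed

end
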